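(* Let $n\ge 2$ and let $\tfrac12\le r_1,r_2,\ldots,r_{n-1}<1$ be constants. Define biased-permutation probabilities on $[n]$ by $p_{i,j}=r_i$ and $p_{j,i}=1-r_i$ for all $1\le i<j\le n$. Consider the Markov chain $\mathcal{M}_{inv}$ on $S_n$ with these $p_{i,j}$ (defined in the context). 1. If each $r_i>1/2$ (i.e. each $r_i$ is a constant strictly larger than $1/2$), then the mixing time of $\mathcal{M}_{inv}$ satisfies $\tau(\epsilon)=O(n^2\ln(n/\epsilon))$. 2. Otherwise, the mixing time of $\mathcal{M}_{inv}$ satisfies $\tau(\epsilon)=O(n^3\ln(n/\epsilon))$.
   Context: A permutation $\sigma\in S_n$ is written as the list $\sigma(1),\ldots,\sigma(n)$. Given probabilities $p_{i,j}\in[0,1]$ for $i\neq j$ in $[n]$ with $p_{j,i}=1-p_{i,j}$ and $p_{i,j}\ge 1/2$ for $i<j$, the target distribution is $\pi(\sigma)=Z^{-1}\prod_{a \text{ before } b \text{ in } \sigma} p_{a,b}$, with $Z$ the normalizing constant. The chain $\mathcal{M}_{inv}$: from $\sigma_t$, select an element $i\in[n]$ with probability $(n-i)/\binom{n}{2}$ and a bit $b\in\{-1,+1\}$ uniformly at random. If $b=+1$, let $j$ be the first element after $i$ in $\sigma_t$ with $j>i$ (if it exists); with probability $p_{j,i}/2=(1-r_i)/2$ obtain $\sigma_{t+1}$ by swapping the positions of $i$ and $j$. If $b=-1$, let $j$ be the last element before $i$ in $\sigma_t$ with $j>i$ (if it exists); with probability $p_{i,j}/2=r_i/2$ obtain $\sigma_{t+1}$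 by swapping $i$ and $j$. In all other cases $\sigma_{t+1}=\sigma_t$. Mixing time: for a chain with transition matrix $\mathcal{P}$ and stationary distribution $\pi$, $\|\mathcal{P}^t,\pi\|_{tv}=\max_x\frac12\sum_y|\mathcal{P}^t(x,y)-\pi(y)|$ and $\tau(\epsilon)=\min\{t:\|\mathcal{P}^{t'},\pi\|_{tv}\le\epsilon\ \forall t'\ge t\}$. The $O(\cdot)$ bounds are as $n\to\infty$ with constants not depending on $n$ or $\epsilon$.
   Formalization: Part 1 assumes all r_i ≥ 1/2+δ for a fixed δ>0, with the O-constant depending on δ (it fails if the r_i approach 1/2, e.g. r_i=1/2+1/(i+2)²); part 2 is for "otherwise" with any δ, so it covers all r_i in [1/2,1); ε ranges over 0<ε≤n, where ln(n/ε)≥0. *)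

theory Defs
  imports "HOL-Probability.Probability" "HOL-Combinatorics.Permutations"
begin

text \<open>A chain is given by its kernel: the \<open>(x, y)\<close> entry of the transition matrix is
  \<open>pmf (K x) y\<close>.\<close>

primrec kernel_power :: "('a \<Rightarrow> 'a pmf) \<Rightarrow> nat \<Rightarrow> 'a \<Rightarrow> 'a pmf" where
  "kernel_power K 0 x = return_pmf x"
| "kernel_power K (Suc t) x = bind_pmf (kernel_power K t x) K"

definition tv_distance :: "'a set \<Rightarrow> ('a \<Rightarrow> 'a pmf) \<Rightarrow> ('a \<Rightarrow> real) \<Rightarrow> nat \<Rightarrow> real" where
  "tv_distance S K \<pi> t =
     Max ((\<lambda>x. 1 / 2 * (\<Sum>y\<in>S. \<bar>pmf (kernel_power K t x) y - \<pi> y\<bar>)) ` S)"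

text \<open>The minimum is taken in \<^typ>\<open>enat\<close>, so that it is \<open>\<infinity>\<close> if the chain never gets within
  \<open>\<epsilon>\<close> of \<open>\<pi>\<close> for good.\<close>

definition mixing_time :: "'a set \<Rightarrow> ('a \<Rightarrow> 'a pmf) \<Rightarrow> ('a \<Rightarrow> real) \<Rightarrow> real \<Rightarrow> enat" where
  "mixing_time S K \<pi> \<epsilon> = Inf (enat ` {t. \<forall>t'\<ge>t. tv_distance S K \<pi> t' \<le> \<epsilon>})"

text \<open>A permutation \<open>\<sigma>\<close> stands for the list \<open>\<sigma> 1, \<dots>, \<sigma> n\<close>; the position of the element \<open>a\<close>
  in that list is \<open>inv \<sigma> a\<close>.\<close>

definition Sym :: "nat \<Rightarrow> (nat \<Rightarrow> nat) set" where
  "Sym n = {\<sigma>. \<sigma> permutes {1..n}}"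

definition weight :: "nat \<Rightarrow> (nat \<Rightarrow> nat \<Rightarrow> real) \<Rightarrow> (nat \<Rightarrow> nat) \<Rightarrow> real" where
  "weight n p \<sigma> =
     (\<Prod>(a, b) \<in> {(a, b). a \<in> {1..n} \<and> b \<in> {1..n} \<and> inv \<sigma> a < inv \<sigma> b}. p a b)"

definition target :: "nat \<Rightarrow> (nat \<Rightarrow> nat \<Rightarrow> real) \<Rightarrow> (nat \<Rightarrow> nat) \<Rightarrow> real" where
  "target n p \<sigma> = weight n p \<sigma> / (\<Sum>\<tau>\<in>Sym n. weight n p \<tau>)"

text \<open>The diagonal values are never used.\<close>

definition choose_prob :: "(nat \<Rightarrow> real) \<Rightarrow> nat \<Rightarrow> nat \<Rightarrow> real" where
  "choose_prob r i j = (if i < j then r i else 1 - r j)"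

definition next_larger :: "nat \<Rightarrow> (nat \<Rightarrow> nat) \<Rightarrow> nat \<Rightarrow> nat option" where
  "next_larger n \<sigma> i =
     (let K = {k \<in> {1..n}. inv \<sigma> i < k \<and> i < \<sigma> k}
      in if K = {} then None else Some (\<sigma> (Min K)))"

definition prev_larger :: "nat \<Rightarrow> (nat \<Rightarrow> nat) \<Rightarrow> nat \<Rightarrow> nat option" where
  "prev_larger n \<sigma> i =
     (let K = {k \<in> {1..n}. k < inv \<sigma> i \<and> i < \<sigma> k}
      in if K = {} then None else Some (\<sigma> (Max K)))"

definition select_pmf :: "nat \<Rightarrow> nat pmf" where
  "select_pmf n = embed_pmf (\<lambda>i. if i \<in> {1..n} then real (n - i) / real (n choose 2) else 0)"

lemma pmf_select_pmf:
  assumes "n \<ge> 2"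
  shows "pmf (select_pmf n) i = (if i \<in> {1..n} then real (n - i) / real (n choose 2) else 0)"
proof -
  let ?f = "\<lambda>i. if i \<in> {1..n} then real (n - i) / real (n choose 2) else 0"
  have "(\<Sum>i\<in>{1..n}. n - i) = (\<Sum>i<n. i)"
    by (rule sum.reindex_bij_witness[of _ "\<lambda>k. n - k" "\<lambda>i. n - i"]) auto
  also have "\<dots> = n choose 2"
    by (induction n) (auto simp: numeral_2_eq_2)
  finally have "(\<Sum>i\<in>{1..n}. real (n - i)) = real (n choose 2)"
    by (metis of_nat_sum)
  moreover have "real (n choose 2) > 0"
    using assms by simp
  ultimately have one: "(\<Sum>i\<in>{1..n}. ?f i) = 1"
    by (simp flip: sum_divide_distrib)
  have "(\<integral>\<^sup>+ i. ennreal (?f i) \<partial>count_space UNIV) = (\<Sum>i\<in>{1..n}. ennreal (?f i))"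
    by (rule nn_integral_count_space') auto
  also have "\<dots> = ennreal (\<Sum>i\<in>{1..n}. ?f i)"
    by (rule sum_ennreal) auto
  finally show ?thesis
    unfolding select_pmf_def one by (subst pmf_embed_pmf) auto
qed

text \<open>Swapping the positions of the elements \<open>i\<close> and \<open>j\<close> is \<open>Transposition.transpose i j \<circ> \<sigma>\<close>.\<close>

definition M_inv :: "nat \<Rightarrow> (nat \<Rightarrow> nat \<Rightarrow> real) \<Rightarrow> (nat \<Rightarrow> nat) \<Rightarrow> (nat \<Rightarrow> nat) pmf" where
  "M_inv n p \<sigma> =
     do {
       i \<leftarrow> select_pmf n;
       b \<leftarrow> pmf_of_set {-1, 1 :: int};
       case (if b = 1 then next_larger n \<sigma> i else prev_larger n \<sigma> i) of
         None \<Rightarrow> return_pmf \<sigma>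
       | Some j \<Rightarrow>
           do {
             accept \<leftarrow> bernoulli_pmf ((if b = 1 then p j i else p i j) / 2);
             return_pmf (if accept then Transposition.transpose i j \<circ> \<sigma> else \<sigma>)
           }
     }"

definition tau_inv :: "nat \<Rightarrow> (nat \<Rightarrow> nat \<Rightarrow> real) \<Rightarrow> real \<Rightarrow> enat" where
  "tau_inv n p \<epsilon> = mixing_time (Sym n) (M_inv n p) (target n p) \<epsilon>"

end

theory Submission imports Defs begin

text \<open>
  Write \<open>x\<^sub>i\<close> for the number of elements larger than \<open>i\<close> that precede \<open>i\<close>. When the
  chain swaps \<open>i\<close> and \<open>j\<close>, all elements between them are smaller than \<open>i\<close>, so the swap changes
  \<open>x\<^sub>i\<close> by one and no other coordinate: in the coordinates \<open>(x\<^sub>1, \<dots>, x\<^sub>n)\<close>, which determine the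
  permutation, the chain is a product of lazy walks on \<open>{0..n - i}\<close>, each chosen with probability
  proportional to its length. Run two copies with the same choices. For positive weights
  \<open>w\<^sub>k\<close> on the edges \<open>(k, k + 1)\<close> the weighted distance in coordinate \<open>i\<close> contracts in expectation
  by the factor \<open>1 - c / 4\<close> whenever \<open>i\<close> is chosen, provided that
  \<open>r\<^sub>i w\<^sub>k\<^sub>-\<^sub>1 + (1 - r\<^sub>i) w\<^sub>k\<^sub>+\<^sub>1 \<le> (1 - c) w\<^sub>k\<close> with zero weights outside the segment. For
  \<open>r\<^sub>i \<ge> 1/2 + \<delta>\<close> the geometric weights \<open>w\<^sub>k = (1 + \<delta>)\<^sup>k\<close> give a constant \<open>c\<close>; for
  \<open>r\<^sub>i \<ge> 1/2\<close> an increasing concave quadratic gives \<open>c\<close> of order \<open>(n - i)\<^sup>-\<^sup>2\<close>.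
\<close>

section \<open>Inversion tables\<close>

definition inv_table :: "nat \<Rightarrow> (nat \<Rightarrow> nat) \<Rightarrow> nat \<Rightarrow> nat" where
  "inv_table n \<sigma> k = card {a \<in> {k<..n}. inv \<sigma> a < inv \<sigma> k}"

lemma inv_table_le: "inv_table n \<sigma> k \<le> n - k"
proof -
  have "inv_table n \<sigma> k \<le> card {k<..n}"
    unfolding inv_table_def by (intro card_mono) auto
  then show ?thesis by simp
qed

text \<open>By \<open>gap\<close>, every element standing between \<open>i\<close> and
  \<open>j\<close> is smaller than \<open>i\<close>. An element \<open>k > i\<close> other than
  \<open>j\<close> therefore lies on the same side of both, and \<open>j\<close> passes no element
  larger than itself on its way to the place of \<open>i\<close>. Only the pair
  \<open>(i, j)\<close> is newly inverted.\<close>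

lemma inv_table_Suc_swap:
  assumes \<sigma>: "\<sigma> \<in> Sym n" and ij: "i < j" "j \<le> n" "inv \<sigma> i < inv \<sigma> j"
    and gap: "\<And>a. \<lbrakk>i < a; a \<le> n; inv \<sigma> i < inv \<sigma> a\<rbrakk> \<Longrightarrow> inv \<sigma> j \<le> inv \<sigma> a"
  shows "inv_table n (Transposition.transpose i j \<circ> \<sigma>) =
    (inv_table n \<sigma>)(i := Suc (inv_table n \<sigma> i))"
proof -
  define \<tau> where "\<tau> = Transposition.transpose i j \<circ> \<sigma>"
  let ?t = "Transposition.transpose i j"
  have bij: "bij \<sigma>" using \<sigma> permutes_bij unfolding Sym_def by blast
  then have injs: "inv \<sigma> a = inv \<sigma> b \<longleftrightarrow> a = b" for a b
    by (metis bij_inv_eq_iff)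
  have inv\<tau>: "inv \<tau> a = inv \<sigma> (?t a)" for a
    unfolding \<tau>_def using bij by (simp add: o_inv_distrib)
  have "inv_table n \<tau> k = ((inv_table n \<sigma>)(i := Suc (inv_table n \<sigma> i))) k" for k
  proof -
    consider "k = i" | "k = j" | "k > i" "k \<noteq> j" | "k < i" by linarith
    then show ?thesis
    proof cases
      case 1
      have "{a \<in> {i<..n}. inv \<tau> a < inv \<tau> i} = insert j {a \<in> {i<..n}. inv \<sigma> a < inv \<sigma> i}"
      proof -
        have "inv \<tau> a < inv \<tau> i \<longleftrightarrow> a = j \<or> inv \<sigma> a < inv \<sigma> i" if "a \<in> {i<..n}" for a
        proof (cases "a = j")
          case False
          then have "?t a = a" using that by (auto simp: Transposition.transpose_def)
          moreover have "inv \<sigma> a \<noteq> inv \<sigma> i" using that injs by simp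
          ultimately show ?thesis using False gap[of a] that ij
            by (cases "inv \<sigma> a < inv \<sigma> i") (auto simp: inv\<tau> Transposition.transpose_def not_less)
        qed (use ij in \<open>auto simp: inv\<tau> Transposition.transpose_def\<close>)
        then show ?thesis using ij by auto
      qed
      then show ?thesis using 1 ij by (simp add: inv_table_def)
    next
      case 2
      have "{a \<in> {j<..n}. inv \<tau> a < inv \<tau> j} = {a \<in> {j<..n}. inv \<sigma> a < inv \<sigma> j}"
      proof (intro Collect_cong conj_cong refl)
        fix a assume a: "a \<in> {j<..n}"
        then have "?t a = a" using ij by (auto simp: Transposition.transpose_def)
        moreover have "inv \<sigma> a \<noteq> inv \<sigma> i" using a ij injs by simp
        ultimately show "inv \<tau> a < inv \<tau> j \<longleftrightarrow> inv \<sigma> a < inv \<sigma> j"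
          using gap[of a] a ij
          by (cases "inv \<sigma> a < inv \<sigma> i") (auto simp: inv\<tau> Transposition.transpose_def not_less)
      qed
      then show ?thesis using 2 ij by (simp add: inv_table_def)
    next
      case 3
      have "{a \<in> {k<..n}. inv \<tau> a < inv \<tau> k} = {a \<in> {k<..n}. inv \<sigma> a < inv \<sigma> k}"
      proof (intro Collect_cong conj_cong refl)
        fix a assume a: "a \<in> {k<..n}"
        have k: "inv \<sigma> k \<noteq> inv \<sigma> i" "inv \<sigma> k \<noteq> inv \<sigma> j" using 3 injs by auto
        have "?t k = k" using 3 by (auto simp: Transposition.transpose_def)
        moreover have "?t a = (if a = j then i else a)"
          using a 3 ij by (auto simp: Transposition.transpose_def)
        ultimately show "inv \<tau> a < inv \<tau> k \<longleftrightarrow> inv \<sigma> a < inv \<sigma> k"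
          using gap[of k] a ij 3 k by (auto simp: inv\<tau>)
      qed
      then show ?thesis using 3 by (simp add: inv_table_def)
    next
      case 4
      have tk: "?t k = k" using 4 ij by (auto simp: Transposition.transpose_def)
      have rng: "?t a \<in> {k<..n} \<longleftrightarrow> a \<in> {k<..n}" for a
        using 4 ij by (auto simp: Transposition.transpose_def)
      \<comment> \<open>For \<open>k < i\<close> the set of larger elements preceding
        \<open>k\<close> may really change, since \<open>i\<close> and \<open>j\<close> trade
        places. The transposition maps the old set bijectively onto the new one, so the count
        survives.\<close>
      have "{a \<in> {k<..n}. inv \<tau> a < inv \<tau> k} = ?t ` {a \<in> {k<..n}. inv \<sigma> a < inv \<sigma> k}"
      proof (intro set_eqI iffI)
        fix a assume a: "a \<in> {a \<in> {k<..n}. inv \<tau> a < inv \<tau> k}"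
        then have "?t a \<in> {a \<in> {k<..n}. inv \<sigma> a < inv \<sigma> k}"
          using rng[of a] by (auto simp: inv\<tau> tk)
        then show "a \<in> ?t ` {a \<in> {k<..n}. inv \<sigma> a < inv \<sigma> k}"
          by (metis imageI transpose_involutory)
      next
        fix a assume "a \<in> ?t ` {a \<in> {k<..n}. inv \<sigma> a < inv \<sigma> k}"
        then obtain b where "b \<in> {k<..n}" "inv \<sigma> b < inv \<sigma> k" "a = ?t b" by blast
        then show "a \<in> {a \<in> {k<..n}. inv \<tau> a < inv \<tau> k}"
          using rng[of b] by (simp add: inv\<tau> tk)
      qed
      then show ?thesis using 4
        by (simp add: inv_table_def card_image)
    qed
  qed
  then show ?thesis unfolding \<tau>_def by blast
qed

text \<open>The elements before \<open>a\<close> occupy exactly the positions below that of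
  \<open>a\<close>. This converts agreement of relative orders into agreement of positions.\<close>

lemma permutes_inv_eq_card:
  assumes "\<sigma> permutes {1..n}" "a \<in> {1..n}"
  shows "inv \<sigma> a = Suc (card {b \<in> {1..n}. inv \<sigma> b < inv \<sigma> a})"
proof -
  have p: "inv \<sigma> permutes {1..n}" using assms permutes_inv by blast
  have "inv \<sigma> ` {b \<in> {1..n}. inv \<sigma> b < inv \<sigma> a} = {1..<inv \<sigma> a}"
  proof (intro set_eqI iffI)
    fix x assume x: "x \<in> {1..<inv \<sigma> a}"
    moreover have "inv \<sigma> a \<in> {1..n}" using permutes_in_image[OF p] assms(2) by blast
    ultimately have "x \<in> {1..n}" by auto
    then have "\<sigma> x \<in> {1..n}" using permutes_in_image[OF assms(1)] by blast
    moreover have "inv \<sigma> (\<sigma> x) = x" using permutes_inverses(2)[OF assms(1)] by blast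
    ultimately show "x \<in> inv \<sigma> ` {b \<in> {1..n}. inv \<sigma> b < inv \<sigma> a}" using x
      by (metis (mono_tags, lifting) atLeastLessThan_iff imageI mem_Collect_eq)
  next
    fix x assume "x \<in> inv \<sigma> ` {b \<in> {1..n}. inv \<sigma> b < inv \<sigma> a}"
    then obtain b where "b \<in> {1..n}" "inv \<sigma> b < inv \<sigma> a" "x = inv \<sigma> b" by blast
    then show "x \<in> {1..<inv \<sigma> a}" using permutes_in_image[OF p, of b] by simp
  qed
  then have "card {b \<in> {1..n}. inv \<sigma> b < inv \<sigma> a} = card {1..<inv \<sigma> a}"
    using card_image permutes_inj_on[OF p] by metis
  moreover have "inv \<sigma> a \<in> {1..n}" using permutes_in_image[OF p] assms(2) by blast
  ultimately show ?thesis by simp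
qed

text \<open>Insert the elements in the order n, n - 1, ..., 1: the entry for \<open>k\<close> says
  after how many of the larger elements \<open>k\<close> is placed, so the relative order of the
  elements above n - d is determined for every \<open>d\<close>. The entry for \<open>n\<close> is
  always 0, so the indices below \<open>n\<close> suffice.\<close>

lemma inv_table_inject:
  assumes \<sigma>: "\<sigma> \<in> Sym n" and \<tau>: "\<tau> \<in> Sym n"
    and eq: "\<And>k. k \<in> {1..<n} \<Longrightarrow> inv_table n \<sigma> k = inv_table n \<tau> k"
  shows "\<sigma> = \<tau>"
proof -
  have ps: "\<sigma> permutes {1..n}" "\<tau> permutes {1..n}" using \<sigma> \<tau> by (auto simp: Sym_def)
  have i\<sigma>: "inv \<sigma> a = inv \<sigma> b \<longleftrightarrow> a = b" for a b
    using ps(1) by (metis permutes_inverses(1))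
  have i\<tau>: "inv \<tau> a = inv \<tau> b \<longleftrightarrow> a = b" for a b
    using ps(2) by (metis permutes_inverses(1))
  have order: "\<forall>a\<in>{n-d<..n}. \<forall>b\<in>{n-d<..n}. inv \<sigma> a < inv \<sigma> b \<longleftrightarrow> inv \<tau> a < inv \<tau> b" for d
  proof (induction d)
    case (Suc d)
    show ?case
    proof (cases "d < n")
      case True
      define k where "k = n - d"
      have k: "k \<ge> 1" "k \<le> n" "n - Suc d = k - 1" using True by (auto simp: k_def)
      note IH = Suc.IH[folded k_def]
      let ?A = "{a \<in> {k<..n}. inv \<sigma> a < inv \<sigma> k}" and ?B = "{a \<in> {k<..n}. inv \<tau> a < inv \<tau> k}"
      have "card ?A = card ?B"
        using eq[of k] k by (cases "k = n") (auto simp: inv_table_def)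
      \<comment> \<open>By the induction hypothesis both sets are initial segments of one and the
        same linear order on the elements above \<open>k\<close>, hence nested. Equal cardinality
        then makes them equal.\<close>
      moreover have "?A \<subseteq> ?B \<or> ?B \<subseteq> ?A"
      proof (rule ccontr)
        assume "\<not> ?thesis"
        then obtain a b where a: "a \<in> ?A" "a \<notin> ?B" and b: "b \<in> ?B" "b \<notin> ?A" by blast
        have "a \<noteq> k" "b \<noteq> k" using a b by auto
        then have "inv \<sigma> a < inv \<sigma> b" "\<not> inv \<tau> a < inv \<tau> b"
          using a b i\<sigma>[of b k] i\<tau>[of a k] by auto
        then show False using IH a b by auto
      qed
      ultimately have "?A = ?B"
        using card_subset_eq[of ?A ?B] card_subset_eq[of ?B ?A] by auto
      then have ak: "inv \<sigma> a < inv \<sigma> k \<longleftrightarrow> inv \<tau> a < inv \<tau> k" if "a \<in> {k<..n}" for a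
        using that by blast
      have ka: "inv \<sigma> k < inv \<sigma> a \<longleftrightarrow> inv \<tau> k < inv \<tau> a" if "a \<in> {k<..n}" for a
        using ak[OF that] i\<sigma>[of a k] i\<tau>[of a k] that by (metis greaterThanAtMost_iff
            less_irrefl not_less_iff_gr_or_eq)
      have ins: "{k - 1<..n} = insert k {k<..n}" using k by auto
      show ?thesis unfolding k(3) ins using IH ak ka by auto
    qed (use Suc.IH in auto)
  qed simp
  have "inv \<sigma> a = inv \<tau> a" for a
  proof (cases "a \<in> {1..n}")
    case True
    have "{b \<in> {1..n}. inv \<sigma> b < inv \<sigma> a} = {b \<in> {1..n}. inv \<tau> b < inv \<tau> a}"
      using order[of n] True by auto
    then show ?thesis
      by (intro box_equals[OF _ permutes_inv_eq_card[OF ps(1) True, symmetric]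
            permutes_inv_eq_card[OF ps(2) True, symmetric]]) simp
  next
    case False
    then show ?thesis using ps[THEN permutes_inv] by (simp add: permutes_not_in)
  qed
  then have "inv \<sigma> = inv \<tau>" by blast
  then show ?thesis using ps by (metis permutes_inv_inv)
qed

section \<open>The moves of the chain as maps on permutations\<close>

definition raise :: "nat \<Rightarrow> nat \<Rightarrow> (nat \<Rightarrow> nat) \<Rightarrow> nat \<Rightarrow> nat" where
  "raise n i \<sigma> = (case next_larger n \<sigma> i of None \<Rightarrow> \<sigma> | Some j \<Rightarrow> Transposition.transpose i j \<circ> \<sigma>)"

definition lower :: "nat \<Rightarrow> nat \<Rightarrow> (nat \<Rightarrow> nat) \<Rightarrow> nat \<Rightarrow> nat" where
  "lower n i \<sigma> = (case prev_larger n \<sigma> i of None \<Rightarrow> \<sigma> | Some j \<Rightarrow> Transposition.transpose i j \<circ> \<sigma>)"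

lemma transpose_comp_in_Sym:
  "\<lbrakk>\<sigma> \<in> Sym n; i \<in> {1..n}; j \<in> {1..n}\<rbrakk> \<Longrightarrow> Transposition.transpose i j \<circ> \<sigma> \<in> Sym n"
  by (simp add: Sym_def permutes_compose permutes_swap_id)

lemma next_larger_SomeD:
  assumes "\<sigma> \<in> Sym n" "next_larger n \<sigma> i = Some j"
  shows "i < j" "j \<in> {1..n}" "inv \<sigma> i < inv \<sigma> j"
    "\<And>a. \<lbrakk>i < a; a \<le> n; inv \<sigma> i < inv \<sigma> a\<rbrakk> \<Longrightarrow> inv \<sigma> j \<le> inv \<sigma> a"
proof -
  define K where "K = {k \<in> {1..n}. inv \<sigma> i < k \<and> i < \<sigma> k}"
  have p: "\<sigma> permutes {1..n}" using assms by (simp add: Sym_def)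
  have K: "K \<noteq> {}" "j = \<sigma> (Min K)" "finite K"
    using assms(2) by (auto simp: next_larger_def Let_def K_def split: if_splits)
  then have "Min K \<in> K" by simp
  then have mem: "Min K \<in> {1..n}" "inv \<sigma> i < Min K" "i < \<sigma> (Min K)"
    by (auto simp: K_def)
  have ij: "inv \<sigma> j = Min K" using K(2) permutes_inverses(2)[OF p] by simp
  show "i < j" using K(2) mem by simp
  show "j \<in> {1..n}" using K(2) mem(1) permutes_in_image[OF p] by blast
  show "inv \<sigma> i < inv \<sigma> j" using ij mem by simp
  fix a assume a: "i < a" "a \<le> n" "inv \<sigma> i < inv \<sigma> a"
  then have "a \<in> {1..n}" by auto
  then have "inv \<sigma> a \<in> {1..n}" using permutes_in_image[OF permutes_inv[OF p]] by blast
  moreover have "\<sigma> (inv \<sigma> a) = a" using permutes_inverses(1)[OF p] by blast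
  ultimately have "inv \<sigma> a \<in> K" using a by (simp add: K_def)
  then show "inv \<sigma> j \<le> inv \<sigma> a" using ij K by simp
qed

lemma prev_larger_SomeD:
  assumes "\<sigma> \<in> Sym n" "prev_larger n \<sigma> i = Some j"
  shows "i < j" "j \<in> {1..n}" "inv \<sigma> j < inv \<sigma> i"
    "\<And>a. \<lbrakk>i < a; a \<le> n; inv \<sigma> a < inv \<sigma> i\<rbrakk> \<Longrightarrow> inv \<sigma> a \<le> inv \<sigma> j"
proof -
  define K where "K = {k \<in> {1..n}. k < inv \<sigma> i \<and> i < \<sigma> k}"
  have p: "\<sigma> permutes {1..n}" using assms by (simp add: Sym_def)
  have K: "K \<noteq> {}" "j = \<sigma> (Max K)" "finite K"
    using assms(2) by (auto simp: prev_larger_def Let_def K_def split: if_splits)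
  then have "Max K \<in> K" by simp
  then have mem: "Max K \<in> {1..n}" "Max K < inv \<sigma> i" "i < \<sigma> (Max K)"
    by (auto simp: K_def)
  have ij: "inv \<sigma> j = Max K" using K(2) permutes_inverses(2)[OF p] by simp
  show "i < j" using K(2) mem by simp
  show "j \<in> {1..n}" using K(2) mem(1) permutes_in_image[OF p] by blast
  show "inv \<sigma> j < inv \<sigma> i" using ij mem by simp
  fix a assume a: "i < a" "a \<le> n" "inv \<sigma> a < inv \<sigma> i"
  then have "a \<in> {1..n}" by auto
  then have "inv \<sigma> a \<in> {1..n}" using permutes_in_image[OF permutes_inv[OF p]] by blast
  moreover have "\<sigma> (inv \<sigma> a) = a" using permutes_inverses(1)[OF p] by blast
  ultimately have "inv \<sigma> a \<in> K" using a by (simp add: K_def)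
  then show "inv \<sigma> a \<le> inv \<sigma> j" using ij K by simp
qed

text \<open>No larger element follows \<open>i\<close> exactly when all \<open>n - i\<close> of them
  precede it, that is, when the walk in coordinate \<open>i\<close> is at the upper end of its
  segment.\<close>

lemma next_larger_None_iff:
  assumes "\<sigma> \<in> Sym n"
  shows "next_larger n \<sigma> i = None \<longleftrightarrow> inv_table n \<sigma> i = n - i"
proof -
  define K where "K = {k \<in> {1..n}. inv \<sigma> i < k \<and> i < \<sigma> k}"
  have p: "\<sigma> permutes {1..n}" using assms by (simp add: Sym_def)
  have ne: "inv \<sigma> a \<noteq> inv \<sigma> i" if "a \<noteq> i" for a using p that by (metis permutes_inverses(1))
  have "next_larger n \<sigma> i = None \<longleftrightarrow> K = {}" by (simp add: next_larger_def Let_def K_def)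
  also have "\<dots> \<longleftrightarrow> {a \<in> {i<..n}. inv \<sigma> a < inv \<sigma> i} = {i<..n}"
  proof
    assume K: "K = {}"
    have "inv \<sigma> a < inv \<sigma> i" if a: "a \<in> {i<..n}" for a
    proof (rule ccontr)
      assume "\<not> ?thesis"
      then have "inv \<sigma> i < inv \<sigma> a" using ne[of a] a by auto
      moreover have "inv \<sigma> a \<in> {1..n}"
        using permutes_in_image[OF permutes_inv[OF p], of a] a by simp
      moreover have "\<sigma> (inv \<sigma> a) = a" using permutes_inverses(1)[OF p] by blast
      ultimately have "inv \<sigma> a \<in> K" using a by (simp add: K_def)
      then show False using K by simp
    qed
    then show "{a \<in> {i<..n}. inv \<sigma> a < inv \<sigma> i} = {i<..n}" by auto
  next
    assume E: "{a \<in> {i<..n}. inv \<sigma> a < inv \<sigma> i} = {i<..n}"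
    show "K = {}"
    proof (rule ccontr)
      assume "K \<noteq> {}"
      then obtain k where k: "k \<in> {1..n}" "inv \<sigma> i < k" "i < \<sigma> k" by (auto simp: K_def)
      then have "\<sigma> k \<in> {i<..n}" using permutes_in_image[OF p, of k] by simp
      then have "inv \<sigma> (\<sigma> k) < inv \<sigma> i" using E by blast
      then show False using k permutes_inverses(2)[OF p] by simp
    qed
  qed
  also have "\<dots> \<longleftrightarrow> inv_table n \<sigma> i = n - i"
  proof
    assume "inv_table n \<sigma> i = n - i"
    then show "{a \<in> {i<..n}. inv \<sigma> a < inv \<sigma> i} = {i<..n}"
      unfolding inv_table_def by (intro card_subset_eq) auto
  qed (simp add: inv_table_def)
  finally show ?thesis .
qed

lemma prev_larger_None_iff:
  assumes "\<sigma> \<in> Sym n"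
  shows "prev_larger n \<sigma> i = None \<longleftrightarrow> inv_table n \<sigma> i = 0"
proof -
  define K where "K = {k \<in> {1..n}. k < inv \<sigma> i \<and> i < \<sigma> k}"
  have p: "\<sigma> permutes {1..n}" using assms by (simp add: Sym_def)
  have "K = inv \<sigma> ` {a \<in> {i<..n}. inv \<sigma> a < inv \<sigma> i}"
  proof (intro set_eqI iffI)
    fix k assume k: "k \<in> K"
    then have "\<sigma> k \<in> {a \<in> {i<..n}. inv \<sigma> a < inv \<sigma> i}"
      using permutes_in_image[OF p, of k] permutes_inverses(2)[OF p] by (auto simp: K_def)
    then show "k \<in> inv \<sigma> ` {a \<in> {i<..n}. inv \<sigma> a < inv \<sigma> i}"
      using permutes_inverses(2)[OF p] by (metis imageI)
  next
    fix k assume "k \<in> inv \<sigma> ` {a \<in> {i<..n}. inv \<sigma> a < inv \<sigma> i}"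
    then obtain a where a: "a \<in> {1..n}" "i < a" "inv \<sigma> a < inv \<sigma> i" "k = inv \<sigma> a" by auto
    then show "k \<in> K"
      using permutes_in_image[OF permutes_inv[OF p], of a] permutes_inverses(1)[OF p]
      by (auto simp: K_def)
  qed
  moreover have "prev_larger n \<sigma> i = None \<longleftrightarrow> K = {}"
    by (simp add: prev_larger_def Let_def K_def)
  ultimately show ?thesis by (simp add: inv_table_def)
qed

lemma raise_in_Sym: "\<lbrakk>\<sigma> \<in> Sym n; i \<in> {1..n}\<rbrakk> \<Longrightarrow> raise n i \<sigma> \<in> Sym n"
  by (auto simp: raise_def split: option.split intro!: transpose_comp_in_Sym
      dest: next_larger_SomeD(2))

lemma lower_in_Sym: "\<lbrakk>\<sigma> \<in> Sym n; i \<in> {1..n}\<rbrakk> \<Longrightarrow> lower n i \<sigma> \<in> Sym n"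
  by (auto simp: lower_def split: option.split intro!: transpose_comp_in_Sym
      dest: prev_larger_SomeD(2))

text \<open>At the end of the segment the move is the identity, which matches the chain holding when
  no partner for a swap exists.\<close>

lemma raise_top: "\<lbrakk>\<sigma> \<in> Sym n; inv_table n \<sigma> i = n - i\<rbrakk> \<Longrightarrow> raise n i \<sigma> = \<sigma>"
  by (simp add: raise_def next_larger_None_iff[THEN iffD2])

lemma lower_bot: "\<lbrakk>\<sigma> \<in> Sym n; inv_table n \<sigma> i = 0\<rbrakk> \<Longrightarrow> lower n i \<sigma> = \<sigma>"
  by (simp add: lower_def prev_larger_None_iff[THEN iffD2])

lemma inv_table_raise:
  assumes "\<sigma> \<in> Sym n" "inv_table n \<sigma> i < n - i"
  shows "inv_table n (raise n i \<sigma>) = (inv_table n \<sigma>)(i := Suc (inv_table n \<sigma> i))"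
proof -
  have "next_larger n \<sigma> i \<noteq> None" using next_larger_None_iff[OF assms(1)] assms(2) by simp
  then obtain j where j: "next_larger n \<sigma> i = Some j" by auto
  note D = next_larger_SomeD[OF assms(1) j]
  have "j \<le> n" using D(2) by simp
  show ?thesis using inv_table_Suc_swap[OF assms(1) D(1) \<open>j \<le> n\<close> D(3) D(4)]
    by (simp add: raise_def j)
qed

text \<open>Let \<tau> be the permutation after the swap. There \<open>i\<close> precedes
  \<open>j\<close> with no larger element between, and swapping back gives \<sigma>, so the result
  for upward swaps applies to \<tau> and is read backwards.\<close>

lemma inv_table_lower:
  assumes \<sigma>: "\<sigma> \<in> Sym n" and "i \<in> {1..n}" "inv_table n \<sigma> i > 0"
  shows "inv_table n (lower n i \<sigma>) = (inv_table n \<sigma>)(i := inv_table n \<sigma> i - 1)"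
proof -
  let ?t = "Transposition.transpose i"
  have "prev_larger n \<sigma> i \<noteq> None" using prev_larger_None_iff[OF \<sigma>] assms(3) by simp
  then obtain j where j: "prev_larger n \<sigma> i = Some j" by auto
  note D = prev_larger_SomeD[OF \<sigma> j]
  define \<tau> where "\<tau> = ?t j \<circ> \<sigma>"
  have bij: "bij \<sigma>" using \<sigma> permutes_bij unfolding Sym_def by blast
  have inv\<tau>: "inv \<tau> a = inv \<sigma> (?t j a)" for a
    unfolding \<tau>_def using bij by (simp add: o_inv_distrib)
  have \<tau>: "\<tau> \<in> Sym n" unfolding \<tau>_def using \<sigma> assms(2) D(2) by (rule transpose_comp_in_Sym)
  have "inv_table n (?t j \<circ> \<tau>) = (inv_table n \<tau>)(i := Suc (inv_table n \<tau> i))"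
  proof (rule inv_table_Suc_swap[OF \<tau> D(1)])
    show "j \<le> n" using D(2) by simp
    show "inv \<tau> i < inv \<tau> j" using D(3) by (simp add: inv\<tau>)
    fix a assume a: "i < a" "a \<le> n" "inv \<tau> i < inv \<tau> a"
    show "inv \<tau> j \<le> inv \<tau> a"
    proof (cases "a = j")
      case False
      then have "?t j a = a" using a by (auto simp: Transposition.transpose_def)
      then show ?thesis using D(4)[of a] a by (force simp: inv\<tau>)
    qed simp
  qed
  moreover have "?t j \<circ> \<tau> = \<sigma>" by (simp add: \<tau>_def fun_eq_iff)
  ultimately have "inv_table n \<sigma> = (inv_table n \<tau>)(i := Suc (inv_table n \<tau> i))" by simp
  then show ?thesis by (simp add: lower_def j flip: \<tau>_def)
qed

text \<open>Both sides have the same inversion table, and the table determines the permutation, so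
  no argument about positions in the list is needed.\<close>

lemma lower_raise:
  assumes "\<sigma> \<in> Sym n" "i \<in> {1..n}" "inv_table n \<sigma> i < n - i"
  shows "lower n i (raise n i \<sigma>) = \<sigma>"
proof (rule inv_table_inject)
  fix k
  show "inv_table n (lower n i (raise n i \<sigma>)) k = inv_table n \<sigma> k"
    using assms by (simp add: inv_table_lower inv_table_raise raise_in_Sym)
qed (use assms in \<open>simp_all add: lower_in_Sym raise_in_Sym del: atLeastAtMost_iff\<close>)

lemma raise_lower:
  assumes "\<sigma> \<in> Sym n" "i \<in> {1..n}" "0 < inv_table n \<sigma> i"
  shows "raise n i (lower n i \<sigma>) = \<sigma>"
proof (rule inv_table_inject)
  fix k
  have "inv_table n \<sigma> i - 1 < n - i" using inv_table_le[of n \<sigma> i] assms(3) by linarith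
  then show "inv_table n (raise n i (lower n i \<sigma>)) k = inv_table n \<sigma> k"
    using assms by (simp add: inv_table_lower inv_table_raise lower_in_Sym)
qed (use assms in \<open>simp_all add: lower_in_Sym raise_in_Sym del: atLeastAtMost_iff\<close>)

section \<open>Kernels, couplings and mixing times\<close>

lemma set_pmf_kernel_power:
  assumes "\<And>x. x \<in> S \<Longrightarrow> set_pmf (K x) \<subseteq> S" "x \<in> S"
  shows "set_pmf (kernel_power K t x) \<subseteq> S"
  using assms by (induction t) (auto; blast)+

text \<open>If \<open>f\<close> carries one step of \<open>K'\<close> to one step of
  \<open>K\<close>, it does so for every number of steps. With \<open>f\<close> a projection of
  pairs this identifies the marginals of the coupled chain; \<open>S\<close> restricts the
  requirement to genuine pairs of permutations.\<close>

lemma map_kernel_power: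
  assumes K': "\<And>x. x \<in> S \<Longrightarrow> set_pmf (K' x) \<subseteq> S" and x: "x \<in> S"
    and map: "\<And>x. x \<in> S \<Longrightarrow> map_pmf f (K' x) = K (f x)"
  shows "map_pmf f (kernel_power K' t x) = kernel_power K t (f x)"
proof (induction t)
  case (Suc t)
  have "map_pmf f (kernel_power K' (Suc t) x) = bind_pmf (kernel_power K' t x) (\<lambda>z. map_pmf f (K' z))"
    by (simp add: map_bind_pmf)
  also have "\<dots> = bind_pmf (kernel_power K' t x) (\<lambda>z. K (f z))"
    using set_pmf_kernel_power[of S K' x t, OF K' x] map by (intro bind_pmf_cong) blast+
  also have "\<dots> = bind_pmf (map_pmf f (kernel_power K' t x)) K"
    by (simp add: bind_map_pmf)
  finally show ?case using Suc.IH by simp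
qed simp

lemma expectation_kernel_power_le:
  fixes d :: "'a \<Rightarrow> real"
  assumes S: "finite S" and K: "\<And>x. x \<in> S \<Longrightarrow> set_pmf (K x) \<subseteq> S" and x: "x \<in> S"
    and c: "0 \<le> c" and le: "\<And>x. x \<in> S \<Longrightarrow> measure_pmf.expectation (K x) d \<le> c * d x"
  shows "measure_pmf.expectation (kernel_power K t x) d \<le> c ^ t * d x"
proof (induction t)
  case (Suc t)
  have sub: "set_pmf (kernel_power K t x) \<subseteq> S" by (rule set_pmf_kernel_power[OF K x])
  have "measure_pmf.expectation (kernel_power K (Suc t) x) d
      = (\<Sum>a\<in>S. pmf (kernel_power K t x) a *\<^sub>R measure_pmf.expectation (K a) d)"
    unfolding kernel_power.simps
    by (rule pmf_expectation_bind) (use S K sub finite_subset in blast)+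
  also have "\<dots> \<le> (\<Sum>a\<in>S. pmf (kernel_power K t x) a * (c * d a))"
    using le by (intro sum_mono) (auto intro: mult_left_mono)
  also have "\<dots> = c * (\<Sum>a\<in>S. d a * pmf (kernel_power K t x) a)"
    by (simp add: sum_distrib_left mult_ac)
  also have "\<dots> = c * measure_pmf.expectation (kernel_power K t x) d"
    using S sub by (subst integral_measure_pmf_real[of S]) auto
  also have "\<dots> \<le> c * (c ^ t * d x)"
    using c Suc.IH by (rule mult_left_mono[rotated])
  finally show ?case by (simp add: mult_ac)
qed simp

lemma stationary_kernel_power:
  assumes S: "finite S" and K: "\<And>x. x \<in> S \<Longrightarrow> set_pmf (K x) \<subseteq> S"
    and st: "\<And>y. y \<in> S \<Longrightarrow> (\<Sum>x\<in>S. \<pi> x * pmf (K x) y) = \<pi> y" and y: "y \<in> S"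
  shows "(\<Sum>x\<in>S. \<pi> x * pmf (kernel_power K t x) y) = \<pi> y"
  using y
proof (induction t arbitrary: y)
  case 0
  have "(\<Sum>x\<in>S. \<pi> x * pmf (return_pmf x) y) = (\<Sum>x\<in>S. if x = y then \<pi> y else 0)"
    by (intro sum.cong) (auto simp: pmf_return)
  then show ?case using S 0 by simp
next
  case (Suc t)
  have "(\<Sum>x\<in>S. \<pi> x * pmf (kernel_power K (Suc t) x) y)
      = (\<Sum>x\<in>S. \<pi> x * (\<Sum>z\<in>S. pmf (K z) y * pmf (kernel_power K t x) z))"
  proof (intro sum.cong refl)
    fix x assume "x \<in> S"
    then have "set_pmf (kernel_power K t x) \<subseteq> S" by (intro set_pmf_kernel_power[OF K])
    then show "\<pi> x * pmf (kernel_power K (Suc t) x) y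
        = \<pi> x * (\<Sum>z\<in>S. pmf (K z) y * pmf (kernel_power K t x) z)"
      using S by (simp add: pmf_bind) (subst integral_measure_pmf_real[of S]; auto)
  qed
  also have "\<dots> = (\<Sum>z\<in>S. (\<Sum>x\<in>S. \<pi> x * pmf (kernel_power K t x) z) * pmf (K z) y)"
    unfolding sum_distrib_left sum_distrib_right
    by (subst sum.swap) (simp add: mult_ac)
  also have "\<dots> = \<pi> y" using Suc st by simp
  finally show ?case .
qed

text \<open>At each \<open>z\<close> the two marginals share the mass of the diagonal point
  \<open>(z, z)\<close>, so they differ by at most the off-diagonal mass with first or second
  component \<open>z\<close>. Summed over \<open>z\<close>, each off-diagonal pair is counted at
  most twice.\<close>

lemma tv_coupling_le:
  fixes C :: "('a \<times> 'a) pmf"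
  assumes S: "finite S"
  shows "(\<Sum>z\<in>S. \<bar>pmf (map_pmf fst C) z - pmf (map_pmf snd C) z\<bar>)
    \<le> 2 * measure_pmf.prob C {p. fst p \<noteq> snd p}"
proof -
  let ?P = "measure_pmf.prob C"
  let ?A = "\<lambda>z. {p. fst p = z \<and> snd p \<noteq> z}" and ?B = "\<lambda>z. {p. snd p = z \<and> fst p \<noteq> z}"
    and ?E = "\<lambda>z. {p. fst p = z \<and> snd p = z}"
  have f: "pmf (map_pmf fst C) z = ?P (?A z) + ?P (?E z)" for z
    unfolding pmf_map by (subst measure_pmf.finite_measure_Union[symmetric])
      (auto intro!: arg_cong[of _ _ ?P])
  have s: "pmf (map_pmf snd C) z = ?P (?B z) + ?P (?E z)" for z
    unfolding pmf_map by (subst measure_pmf.finite_measure_Union[symmetric])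
      (auto intro!: arg_cong[of _ _ ?P])
  have "(\<Sum>z\<in>S. \<bar>pmf (map_pmf fst C) z - pmf (map_pmf snd C) z\<bar>)
      \<le> (\<Sum>z\<in>S. ?P (?A z) + ?P (?B z))"
  proof (rule sum_mono)
    fix z
    have "0 \<le> ?P (?A z)" "0 \<le> ?P (?B z)" by auto
    then show "\<bar>pmf (map_pmf fst C) z - pmf (map_pmf snd C) z\<bar> \<le> ?P (?A z) + ?P (?B z)"
      unfolding f s by linarith
  qed
  also have "\<dots> = (\<Sum>z\<in>S. ?P (?A z)) + (\<Sum>z\<in>S. ?P (?B z))" by (rule sum.distrib)
  also have "(\<Sum>z\<in>S. ?P (?A z)) = ?P (\<Union>z\<in>S. ?A z)"
    using S by (intro measure_pmf.finite_measure_finite_Union[symmetric])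
      (auto simp: disjoint_family_on_def)
  also have "\<dots> \<le> ?P {p. fst p \<noteq> snd p}" by (intro measure_pmf.finite_measure_mono) auto
  also have "(\<Sum>z\<in>S. ?P (?B z)) = ?P (\<Union>z\<in>S. ?B z)"
    using S by (intro measure_pmf.finite_measure_finite_Union[symmetric])
      (auto simp: disjoint_family_on_def)
  also have "\<dots> \<le> ?P {p. fst p \<noteq> snd p}" by (intro measure_pmf.finite_measure_mono) auto
  finally show ?thesis by simp
qed

text \<open>By stationarity \<pi> is the \<pi>-average of the \<open>t\<close>-step laws over their
  starting points, so the distance to \<pi> is at most the average distance between two such laws.
  The 2 in the hypothesis offsets the 1/2 in the total variation distance.\<close>

lemma tv_distance_le:
  assumes S: "finite S" "S \<noteq> {}" and K: "\<And>x. x \<in> S \<Longrightarrow> set_pmf (K x) \<subseteq> S"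
    and st: "\<And>y. y \<in> S \<Longrightarrow> (\<Sum>x\<in>S. \<pi> x * pmf (K x) y) = \<pi> y"
    and \<pi>: "\<And>x. x \<in> S \<Longrightarrow> \<pi> x \<ge> 0" "(\<Sum>x\<in>S. \<pi> x) = 1"
    and B: "\<And>x y. \<lbrakk>x \<in> S; y \<in> S\<rbrakk> \<Longrightarrow>
      (\<Sum>z\<in>S. \<bar>pmf (kernel_power K t x) z - pmf (kernel_power K t y) z\<bar>) \<le> 2 * B"
  shows "tv_distance S K \<pi> t \<le> B"
proof -
  have "(\<Sum>z\<in>S. \<bar>pmf (kernel_power K t x) z - \<pi> z\<bar>) \<le> 2 * B" if x: "x \<in> S" for x
  proof -
    let ?P = "\<lambda>x. pmf (kernel_power K t x)"
    have "(\<Sum>z\<in>S. \<bar>?P x z - \<pi> z\<bar>) = (\<Sum>z\<in>S. \<bar>\<Sum>y\<in>S. \<pi> y * (?P x z - ?P y z)\<bar>)"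
    proof (intro sum.cong refl)
      fix z assume "z \<in> S"
      then have "\<pi> z = (\<Sum>y\<in>S. \<pi> y * ?P y z)" using stationary_kernel_power[OF S(1) K st] by simp
      moreover have "?P x z = (\<Sum>y\<in>S. \<pi> y * ?P x z)" using \<pi>(2) by (simp flip: sum_distrib_right)
      ultimately show "\<bar>?P x z - \<pi> z\<bar> = \<bar>\<Sum>y\<in>S. \<pi> y * (?P x z - ?P y z)\<bar>"
        by (simp add: right_diff_distrib sum_subtractf)
    qed
    also have "\<dots> \<le> (\<Sum>z\<in>S. \<Sum>y\<in>S. \<bar>\<pi> y * (?P x z - ?P y z)\<bar>)"
      by (intro sum_mono sum_abs)
    also have "\<dots> = (\<Sum>y\<in>S. \<Sum>z\<in>S. \<bar>\<pi> y * (?P x z - ?P y z)\<bar>)" by (rule sum.swap)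
    also have "\<dots> = (\<Sum>y\<in>S. \<pi> y * (\<Sum>z\<in>S. \<bar>?P x z - ?P y z\<bar>))"
      using \<pi>(1) by (intro sum.cong refl) (simp add: abs_mult sum_distrib_left)
    also have "\<dots> \<le> (\<Sum>y\<in>S. \<pi> y * (2 * B))"
      using \<pi>(1) B x by (intro sum_mono mult_left_mono) auto
    also have "\<dots> = 2 * B" using \<pi>(2) by (simp flip: sum_distrib_right)
    finally show ?thesis .
  qed
  then have "1 / 2 * (\<Sum>z\<in>S. \<bar>pmf (kernel_power K t x) z - \<pi> z\<bar>) \<le> B" if "x \<in> S" for x
    using that by fastforce
  then show ?thesis unfolding tv_distance_def using S by (subst Max_le_iff) blast+
qed

text \<open>The least integer at or above \<open>B\<close> is a valid time; rounding costs the extra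
  1.\<close>

lemma mixing_time_le:
  assumes "0 \<le> B" "\<And>t. B \<le> real t \<Longrightarrow> tv_distance S K \<pi> t \<le> \<epsilon>"
  shows "ereal_of_enat (mixing_time S K \<pi> \<epsilon>) \<le> ereal (B + 1)"
proof -
  define T where "T = nat \<lceil>B\<rceil>"
  have "mixing_time S K \<pi> \<epsilon> \<le> enat T"
    unfolding mixing_time_def
  proof (intro Inf_lower imageI CollectI allI impI)
    fix t assume "T \<le> t"
    then show "tv_distance S K \<pi> t \<le> \<epsilon>" unfolding T_def by (intro assms(2)) linarith
  qed
  then have "ereal_of_enat (mixing_time S K \<pi> \<epsilon>) \<le> ereal_of_enat (enat T)"
    by (simp only: ereal_of_enat_le_iff)
  also have "\<dots> \<le> ereal (B + 1)" unfolding T_def using assms(1) by simp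
  finally show ?thesis .
qed

lemma mixing_time_eq_0:
  assumes "\<And>t. tv_distance S K \<pi> t \<le> \<epsilon>"
  shows "mixing_time S K \<pi> \<epsilon> = 0"
proof -
  have "mixing_time S K \<pi> \<epsilon> \<le> enat 0"
    unfolding mixing_time_def using assms by (intro Inf_lower) auto
  then show ?thesis by (simp add: zero_enat_def[symmetric])
qed

section \<open>Stationarity of the target distribution\<close>

text \<open>Each pair of elements contributes one factor, which depends only on the smaller element
  and on whether the pair is inverted. Passing from pairs sorted by position to pairs sorted by
  value and grouping by the smaller element shows that the target is a product measure in the table
  coordinates.\<close>

lemma weight_eq_prod_inv_table:
  assumes \<sigma>: "\<sigma> \<in> Sym n"
  shows "weight n (choose_prob r) \<sigma> =
    (\<Prod>i\<in>{1..n}. r i ^ (n - i - inv_table n \<sigma> i) * (1 - r i) ^ inv_table n \<sigma> i)"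
proof -
  have p: "\<sigma> permutes {1..n}" using assms by (simp add: Sym_def)
  have ne: "inv \<sigma> a = inv \<sigma> b \<longleftrightarrow> a = b" for a b using p by (metis permutes_inverses(1))
  let ?f = "\<lambda>i j. if inv \<sigma> j < inv \<sigma> i then 1 - r i else r i"
  have "weight n (choose_prob r) \<sigma> = (\<Prod>(i, j) \<in> (SIGMA i:{1..n}. {i<..n}). ?f i j)"
    unfolding weight_def
  proof (rule prod.reindex_bij_witness[of _
        "\<lambda>(i, j). if inv \<sigma> j < inv \<sigma> i then (j, i) else (i, j)"
        "\<lambda>(a, b). if a < b then (a, b) else (b, a)"])
    fix x assume "x \<in> {(a, b). a \<in> {1..n} \<and> b \<in> {1..n} \<and> inv \<sigma> a < inv \<sigma> b}"
    then obtain a b where x: "x = (a, b)" "a \<in> {1..n}" "b \<in> {1..n}" "inv \<sigma> a < inv \<sigma> b" by auto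
    then have "a \<noteq> b" by auto
    then show "(case case x of (a, b) \<Rightarrow> if a < b then (a, b) else (b, a) of
          (i, j) \<Rightarrow> if inv \<sigma> j < inv \<sigma> i then (j, i) else (i, j)) = x"
      and "(case x of (a, b) \<Rightarrow> if a < b then (a, b) else (b, a)) \<in> (SIGMA i:{1..n}. {i<..n})"
      and "(case case x of (a, b) \<Rightarrow> if a < b then (a, b) else (b, a) of (i, j) \<Rightarrow> ?f i j)
          = (case x of (a, b) \<Rightarrow> choose_prob r a b)"
      using x by (auto simp: choose_prob_def)
  next
    fix y assume "y \<in> (SIGMA i:{1..n}. {i<..n})"
    then obtain a b where y: "y = (a, b)" "a \<in> {1..n}" "b \<in> {1..n}" "a < b" by auto
    then show "(case case y of (i, j) \<Rightarrow> if inv \<sigma> j < inv \<sigma> i then (j, i) else (i, j) of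
          (a, b) \<Rightarrow> if a < b then (a, b) else (b, a)) = y"
      and "(case y of (i, j) \<Rightarrow> if inv \<sigma> j < inv \<sigma> i then (j, i) else (i, j))
          \<in> {(a, b). a \<in> {1..n} \<and> b \<in> {1..n} \<and> inv \<sigma> a < inv \<sigma> b}"
      using ne[of a b] by (auto simp: linorder_neq_iff)
  qed
  also have "\<dots> = (\<Prod>i\<in>{1..n}. \<Prod>j\<in>{i<..n}. ?f i j)"
    by (rule prod.Sigma[symmetric]) auto
  also have "\<dots> = (\<Prod>i\<in>{1..n}. r i ^ (n - i - inv_table n \<sigma> i) * (1 - r i) ^ inv_table n \<sigma> i)"
  proof (rule prod.cong[OF refl])
    fix i assume "i \<in> {1..n}"
    let ?A = "{i<..n} \<inter> {j. inv \<sigma> j < inv \<sigma> i}"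
    have A: "card ?A = inv_table n \<sigma> i"
      unfolding inv_table_def by (rule arg_cong[of _ _ card]) auto
    have "{i<..n} \<inter> - {j. inv \<sigma> j < inv \<sigma> i} = {i<..n} - ?A" by auto
    then have B: "card ({i<..n} \<inter> - {j. inv \<sigma> j < inv \<sigma> i}) = n - i - inv_table n \<sigma> i"
      using A by (simp add: card_Diff_subset)
    show "(\<Prod>j\<in>{i<..n}. ?f i j) = r i ^ (n - i - inv_table n \<sigma> i) * (1 - r i) ^ inv_table n \<sigma> i"
      by (subst prod.If_cases) (simp_all add: A B)
  qed
  finally show ?thesis .
qed

lemma weight_pos:
  assumes "\<sigma> \<in> Sym n" "\<And>i. i \<in> {1..<n} \<Longrightarrow> 0 < r i \<and> r i < 1"
  shows "weight n (choose_prob r) \<sigma> > 0"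
  unfolding weight_eq_prod_inv_table[OF assms(1)]
proof (rule prod_pos)
  fix i assume i: "i \<in> {1..n}"
  show "0 < r i ^ (n - i - inv_table n \<sigma> i) * (1 - r i) ^ inv_table n \<sigma> i"
  proof (cases "i = n")
    \<comment> \<open>Both exponents are 0 here, so the factor is 1 whatever the value of
      \<open>r n\<close>.\<close>
    case True
    then show ?thesis using inv_table_le[of n \<sigma> n] by simp
  next
    case False
    then show ?thesis using assms(2)[of i] i by simp
  qed
qed

text \<open>Detailed balance for one move: only the factor with index \<open>i\<close> changes, one
  \<open>r i\<close> being replaced by \<open>1 - r i\<close>. The cross-multiplied form avoids
  division.\<close>

lemma weight_raise:
  assumes \<sigma>: "\<sigma> \<in> Sym n" and i: "i \<in> {1..n}" and "inv_table n \<sigma> i < n - i"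
  shows "r i * weight n (choose_prob r) (raise n i \<sigma>) = (1 - r i) * weight n (choose_prob r) \<sigma>"
proof -
  let ?x = "inv_table n \<sigma> i"
  define R where "R = (\<Prod>k\<in>{1..n}-{i}. r k ^ (n - k - inv_table n \<sigma> k) * (1 - r k) ^ inv_table n \<sigma> k)"
  have "weight n (choose_prob r) \<sigma> = r i ^ (n - i - ?x) * (1 - r i) ^ ?x * R"
    unfolding weight_eq_prod_inv_table[OF \<sigma>] R_def by (rule prod.remove) (use i in auto)
  moreover have "weight n (choose_prob r) (raise n i \<sigma>)
      = r i ^ (n - i - Suc ?x) * (1 - r i) ^ Suc ?x * R"
    unfolding weight_eq_prod_inv_table[OF raise_in_Sym[OF \<sigma> i]] inv_table_raise[OF \<sigma> assms(3)] R_def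
    by (subst prod.remove[of _ i]) (use i in \<open>auto intro!: prod.cong\<close>)
  moreover have "n - i - ?x = Suc (n - i - Suc ?x)" using assms(3) by simp
  ultimately show ?thesis by simp
qed

text \<open>The acceptance coin is drawn even if no swap is possible, so that the same randomness can drive
  two copies of the chain.\<close>

definition step_pmf :: "nat \<Rightarrow> (nat \<Rightarrow> real) \<Rightarrow> (nat \<Rightarrow> 'a) \<Rightarrow> (nat \<Rightarrow> 'a) \<Rightarrow> 'a \<Rightarrow> 'a pmf" where
  "step_pmf n r u d s =
     do {
       i \<leftarrow> select_pmf n;
       b \<leftarrow> pmf_of_set {-1, 1 :: int};
       accept \<leftarrow> bernoulli_pmf ((if b = 1 then 1 - r i else r i) / 2);
       return_pmf (if accept then if b = 1 then u i else d i else s)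
     }"

lemma map_step_pmf: "map_pmf f (step_pmf n r u d s) = step_pmf n r (\<lambda>i. f (u i)) (\<lambda>i. f (d i)) (f s)"
  unfolding step_pmf_def map_bind_pmf map_return_pmf by (intro bind_pmf_cong refl) auto

lemma set_select_pmf: "n \<ge> 2 \<Longrightarrow> set_pmf (select_pmf n) \<subseteq> {1..<n}"
  by (auto simp: set_pmf_eq pmf_select_pmf split: if_splits)

lemma sum_select_prob:
  assumes "n \<ge> 2"
  shows "(\<Sum>i\<in>{1..<n}. real (n - i) / real (n choose 2)) = 1"
proof -
  have "(\<Sum>i\<in>{1..<n}. real (n - i) / real (n choose 2)) = (\<Sum>i\<in>{1..<n}. pmf (select_pmf n) i)"
    by (intro sum.cong refl) (simp add: pmf_select_pmf[OF assms])
  also have "\<dots> = 1" using set_select_pmf[OF assms] by (intro sum_pmf_eq_1) auto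
  finally show ?thesis .
qed

text \<open>A coin drawn when no swap is possible does not affect the law. When a partner
  \<open>j\<close> exists it is larger than \<open>i\<close>, so the acceptance probabilities depend
  on \<open>i\<close> alone.\<close>

lemma M_inv_eq_step_pmf:
  assumes "\<sigma> \<in> Sym n"
  shows "M_inv n (choose_prob r) \<sigma> = step_pmf n r (\<lambda>i. raise n i \<sigma>) (\<lambda>i. lower n i \<sigma>) \<sigma>"
  unfolding M_inv_def step_pmf_def
proof (intro bind_pmf_cong refl)
  fix i and b :: int
  show "(case if b = 1 then next_larger n \<sigma> i else prev_larger n \<sigma> i of None \<Rightarrow> return_pmf \<sigma>
      | Some j \<Rightarrow> bernoulli_pmf ((if b = 1 then choose_prob r j i else choose_prob r i j) / 2) \<bind>
          (\<lambda>accept. return_pmf (if accept then Transposition.transpose i j \<circ> \<sigma> else \<sigma>)))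
    = bernoulli_pmf ((if b = 1 then 1 - r i else r i) / 2) \<bind>
      (\<lambda>accept. return_pmf (if accept then if b = 1 then raise n i \<sigma> else lower n i \<sigma> else \<sigma>))"
    using next_larger_SomeD(1)[OF assms, of i] prev_larger_SomeD(1)[OF assms, of i]
    unfolding raise_def lower_def
    by (auto simp: choose_prob_def bind_pmf_const split: option.split cong: if_cong)
qed

text \<open>A direction has probability 1/2 and is then accepted with probability
  \<open>(1 - r i) / 2\<close> or \<open>r i / 2\<close>; the two moves together have probability
  1/4, leaving 3/4 for holding. The sum stops before \<open>n\<close> because the element
  \<open>n\<close> is selected with probability 0.\<close>

lemma expectation_step_pmf:
  fixes h :: "'a \<Rightarrow> real"
  assumes "n \<ge> 2" "\<And>i. i \<in> {1..<n} \<Longrightarrow> 0 \<le> r i \<and> r i \<le> 1"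
  shows "measure_pmf.expectation (step_pmf n r u d s) h =
    (\<Sum>i\<in>{1..<n}. real (n - i) / real (n choose 2) *
      ((1 - r i) / 4 * h (u i) + r i / 4 * h (d i) + 3 / 4 * h s))"
proof -
  define B where "B i b = bernoulli_pmf ((if b = (1::int) then 1 - r i else r i) / 2) \<bind>
      (\<lambda>accept. return_pmf (if accept then if b = 1 then u i else d i else s))" for i b
  have finB: "finite (set_pmf (B i b))" for i b by (simp add: B_def)
  have B: "measure_pmf.expectation (B i b) h =
      (if b = 1 then (1 - r i) / 2 * h (u i) + (1 + r i) / 2 * h s
       else r i / 2 * h (d i) + (2 - r i) / 2 * h s)" if "i \<in> {1..<n}" for i b
    using assms(2)[OF that] unfolding B_def
    by (subst pmf_expectation_bind[of UNIV])
       (auto simp: UNIV_bool field_simps)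
  have *: "measure_pmf.expectation (pmf_of_set {-1, 1 :: int} \<bind> B i) h =
      (1 - r i) / 4 * h (u i) + r i / 4 * h (d i) + 3 / 4 * h s" if "i \<in> {1..<n}" for i
    using finB by (subst pmf_expectation_bind[of "{-1, 1}"]) (auto simp: B[OF that] field_simps)
  have "step_pmf n r u d s = select_pmf n \<bind> (\<lambda>i. pmf_of_set {-1, 1} \<bind> B i)"
    by (simp add: step_pmf_def B_def[abs_def])
  also have "measure_pmf.expectation \<dots> h =
     (\<Sum>i\<in>{1..<n}. pmf (select_pmf n) i *\<^sub>R measure_pmf.expectation (pmf_of_set {-1, 1 :: int} \<bind> B i) h)"
    by (rule pmf_expectation_bind) (use set_select_pmf[OF assms(1)] finB in auto)
  also have "\<dots> = (\<Sum>i\<in>{1..<n}. real (n - i) / real (n choose 2) *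
      ((1 - r i) / 4 * h (u i) + r i / 4 * h (d i) + 3 / 4 * h s))"
    by (intro sum.cong refl) (simp add: * pmf_select_pmf[OF assms(1)])
  finally show ?thesis .
qed

lemma set_step_pmf:
  assumes "n \<ge> 2" "s \<in> S" "\<And>i. i \<in> {1..<n} \<Longrightarrow> u i \<in> S \<and> d i \<in> S"
  shows "set_pmf (step_pmf n r u d s) \<subseteq> S"
  using set_select_pmf[OF assms(1)] assms(2,3) unfolding step_pmf_def set_bind_pmf by force

lemma finite_Sym: "finite (Sym n)"
  by (simp add: Sym_def finite_permutations)

lemma Sym_nonempty: "Sym n \<noteq> {}"
  using permutes_id[of "{1..n}"] unfolding Sym_def by blast

lemma set_M_inv:
  assumes "n \<ge> 2" "\<sigma> \<in> Sym n"
  shows "set_pmf (M_inv n (choose_prob r) \<sigma>) \<subseteq> Sym n"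
  unfolding M_inv_eq_step_pmf[OF assms(2)]
  by (rule set_step_pmf) (use assms in \<open>simp_all add: raise_in_Sym lower_in_Sym\<close>)

text \<open>This is the flow into \<tau> by upward moves. Its sources are
  \<open>lower n i \<tau>\<close>, whose contribution is rewritten by detailed balance, and \<tau>
  itself if it sits at the upper end.\<close>

lemma sum_weight_raise:
  fixes r :: "nat \<Rightarrow> real"
  assumes \<tau>: "\<tau> \<in> Sym n" and i: "i \<in> {1..<n}"
  defines "W \<equiv> weight n (choose_prob r)"
  shows "(\<Sum>\<sigma>\<in>Sym n. W \<sigma> * (1 - r i) * of_bool (raise n i \<sigma> = \<tau>)) =
    (if 0 < inv_table n \<tau> i then r i * W \<tau> else 0) +
    (if inv_table n \<tau> i = n - i then (1 - r i) * W \<tau> else 0)"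
proof -
  let ?x = "inv_table n \<tau> i"
  have i': "i \<in> {1..n}" using i by simp
  let ?A = "if 0 < ?x then {lower n i \<tau>} else {}" and ?B = "if ?x = n - i then {\<tau>} else {}"
  have S: "{\<sigma> \<in> Sym n. raise n i \<sigma> = \<tau>} = ?A \<union> ?B"
  proof (intro set_eqI iffI)
    fix \<sigma> assume "\<sigma> \<in> {\<sigma> \<in> Sym n. raise n i \<sigma> = \<tau>}"
    then have \<sigma>: "\<sigma> \<in> Sym n" "raise n i \<sigma> = \<tau>" by auto
    show "\<sigma> \<in> ?A \<union> ?B"
    proof (cases "inv_table n \<sigma> i < n - i")
      case True
      then have "0 < ?x" using inv_table_raise[OF \<sigma>(1) True] \<sigma>(2) by simp
      then show ?thesis using lower_raise[OF \<sigma>(1) i' True] \<sigma>(2) by simp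
    next
      case False
      then have "inv_table n \<sigma> i = n - i" using inv_table_le[of n \<sigma> i] by simp
      then show ?thesis using raise_top[OF \<sigma>(1)] \<sigma>(2) by simp
    qed
  next
    fix \<sigma> assume "\<sigma> \<in> ?A \<union> ?B"
    then show "\<sigma> \<in> {\<sigma> \<in> Sym n. raise n i \<sigma> = \<tau>}"
      using \<tau> lower_in_Sym[OF \<tau> i'] raise_lower[OF \<tau> i'] raise_top[OF \<tau>, of i]
      by (auto split: if_splits)
  qed
  have low: "W (lower n i \<tau>) * (1 - r i) = r i * W \<tau>" if "0 < ?x"
  proof -
    have "inv_table n (lower n i \<tau>) i < n - i"
      using inv_table_lower[OF \<tau> i' that] inv_table_le[of n \<tau> i] that by simp
    from weight_raise[OF lower_in_Sym[OF \<tau> i'] i' this, of r] show ?thesis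
      using raise_lower[OF \<tau> i' that] by (simp add: W_def mult.commute)
  qed
  have disj: "?A \<inter> ?B = {}"
  proof (cases "0 < ?x")
    case True
    then have "lower n i \<tau> \<noteq> \<tau>"
      using inv_table_lower[OF \<tau> i' True]
      by (metis fun_upd_same diff_less less_irrefl zero_less_one)
    then show ?thesis by auto
  qed simp
  have "(\<Sum>\<sigma>\<in>Sym n. W \<sigma> * (1 - r i) * of_bool (raise n i \<sigma> = \<tau>))
      = (\<Sum>\<sigma>\<in>{\<sigma> \<in> Sym n. raise n i \<sigma> = \<tau>}. W \<sigma> * (1 - r i))"
    using finite_Sym by (intro sum.mono_neutral_cong_right) auto
  also have "\<dots> = (\<Sum>\<sigma>\<in>?A. W \<sigma> * (1 - r i)) + (\<Sum>\<sigma>\<in>?B. W \<sigma> * (1 - r i))"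
    unfolding S by (intro sum.union_disjoint disj) auto
  also have "\<dots> = (if 0 < ?x then r i * W \<tau> else 0) + (if ?x = n - i then (1 - r i) * W \<tau> else 0)"
    using low by (simp add: mult.commute)
  finally show ?thesis .
qed

lemma sum_weight_lower:
  fixes r :: "nat \<Rightarrow> real"
  assumes \<tau>: "\<tau> \<in> Sym n" and i: "i \<in> {1..<n}"
  defines "W \<equiv> weight n (choose_prob r)"
  shows "(\<Sum>\<sigma>\<in>Sym n. W \<sigma> * r i * of_bool (lower n i \<sigma> = \<tau>)) =
    (if inv_table n \<tau> i < n - i then (1 - r i) * W \<tau> else 0) +
    (if inv_table n \<tau> i = 0 then r i * W \<tau> else 0)"
proof -
  let ?x = "inv_table n \<tau> i"
  have i': "i \<in> {1..n}" using i by simp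
  let ?A = "if ?x < n - i then {raise n i \<tau>} else {}" and ?B = "if ?x = 0 then {\<tau>} else {}"
  have S: "{\<sigma> \<in> Sym n. lower n i \<sigma> = \<tau>} = ?A \<union> ?B"
  proof (intro set_eqI iffI)
    fix \<sigma> assume "\<sigma> \<in> {\<sigma> \<in> Sym n. lower n i \<sigma> = \<tau>}"
    then have \<sigma>: "\<sigma> \<in> Sym n" "lower n i \<sigma> = \<tau>" by auto
    show "\<sigma> \<in> ?A \<union> ?B"
    proof (cases "inv_table n \<sigma> i > 0")
      case True
      then have "?x < n - i"
        using inv_table_lower[OF \<sigma>(1) i' True] inv_table_le[of n \<sigma> i] \<sigma>(2) by auto
      then show ?thesis using raise_lower[OF \<sigma>(1) i' True] \<sigma>(2) by simp
    next
      case False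
      then show ?thesis using lower_bot[OF \<sigma>(1)] \<sigma>(2) by simp
    qed
  next
    fix \<sigma> assume "\<sigma> \<in> ?A \<union> ?B"
    then show "\<sigma> \<in> {\<sigma> \<in> Sym n. lower n i \<sigma> = \<tau>}"
      using \<tau> raise_in_Sym[OF \<tau> i'] lower_raise[OF \<tau> i'] lower_bot[OF \<tau>, of i]
      by (auto split: if_splits)
  qed
  have up: "W (raise n i \<tau>) * r i = (1 - r i) * W \<tau>" if "?x < n - i"
    using weight_raise[OF \<tau> i' that, of r] by (simp add: W_def mult.commute)
  have disj: "?A \<inter> ?B = {}"
  proof (cases "?x < n - i")
    case True
    then have "raise n i \<tau> \<noteq> \<tau>" using inv_table_raise[OF \<tau> True] by (metis fun_upd_same n_not_Suc_n)
    then show ?thesis by auto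
  qed simp
  have "(\<Sum>\<sigma>\<in>Sym n. W \<sigma> * r i * of_bool (lower n i \<sigma> = \<tau>))
      = (\<Sum>\<sigma>\<in>{\<sigma> \<in> Sym n. lower n i \<sigma> = \<tau>}. W \<sigma> * r i)"
    using finite_Sym by (intro sum.mono_neutral_cong_right) auto
  also have "\<dots> = (\<Sum>\<sigma>\<in>?A. W \<sigma> * r i) + (\<Sum>\<sigma>\<in>?B. W \<sigma> * r i)"
    unfolding S by (intro sum.union_disjoint disj) auto
  also have "\<dots> = (if ?x < n - i then (1 - r i) * W \<tau> else 0) + (if ?x = 0 then r i * W \<tau> else 0)"
    using up by (simp add: mult.commute)
  finally show ?thesis .
qed

lemma weight_stationary:
  assumes n: "n \<ge> 2" and r: "\<And>i. i \<in> {1..<n} \<Longrightarrow> 0 \<le> r i \<and> r i \<le> 1" and \<tau>: "\<tau> \<in> Sym n"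
  defines "W \<equiv> weight n (choose_prob r)"
  shows "(\<Sum>\<sigma>\<in>Sym n. W \<sigma> * pmf (M_inv n (choose_prob r) \<sigma>) \<tau>) = W \<tau>"
proof -
  let ?s = "\<lambda>i. real (n - i) / real (n choose 2)"
  have pmf: "pmf (M_inv n (choose_prob r) \<sigma>) \<tau> = (\<Sum>i\<in>{1..<n}. ?s i *
      ((1 - r i) / 4 * of_bool (raise n i \<sigma> = \<tau>) + r i / 4 * of_bool (lower n i \<sigma> = \<tau>)
        + 3 / 4 * of_bool (\<sigma> = \<tau>)))" if "\<sigma> \<in> Sym n" for \<sigma>
  proof -
    have "pmf (M_inv n (choose_prob r) \<sigma>) \<tau>
        = measure_pmf.expectation (M_inv n (choose_prob r) \<sigma>) (indicator {\<tau>})"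
      by (simp add: measure_pmf_single)
    also have "indicator {\<tau>} = (\<lambda>x. of_bool (x = \<tau>) :: real)"
      by (auto simp: fun_eq_iff)
    finally show ?thesis unfolding M_inv_eq_step_pmf[OF that]
      by (simp only: expectation_step_pmf[OF n r])
  qed
  have one: "(\<Sum>\<sigma>\<in>Sym n. W \<sigma> * ((1 - r i) / 4 * of_bool (raise n i \<sigma> = \<tau>)
      + r i / 4 * of_bool (lower n i \<sigma> = \<tau>) + 3 / 4 * of_bool (\<sigma> = \<tau>))) = W \<tau>"
    if i: "i \<in> {1..<n}" for i
  proof -
    let ?x = "inv_table n \<tau> i"
    have "(\<Sum>\<sigma>\<in>Sym n. W \<sigma> * of_bool (\<sigma> = \<tau>)) = (\<Sum>\<sigma>\<in>Sym n. if \<sigma> = \<tau> then W \<tau> else 0)"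
      by (intro sum.cong) auto
    then have 3: "(\<Sum>\<sigma>\<in>Sym n. W \<sigma> * of_bool (\<sigma> = \<tau>)) = W \<tau>" using \<tau> finite_Sym by simp
    have x: "?x \<le> n - i" by (rule inv_table_le)
    have "(\<Sum>\<sigma>\<in>Sym n. W \<sigma> * ((1 - r i) / 4 * of_bool (raise n i \<sigma> = \<tau>)
      + r i / 4 * of_bool (lower n i \<sigma> = \<tau>) + 3 / 4 * of_bool (\<sigma> = \<tau>))) =
      1 / 4 * (\<Sum>\<sigma>\<in>Sym n. W \<sigma> * (1 - r i) * of_bool (raise n i \<sigma> = \<tau>)) +
      1 / 4 * (\<Sum>\<sigma>\<in>Sym n. W \<sigma> * r i * of_bool (lower n i \<sigma> = \<tau>)) +
      3 / 4 * (\<Sum>\<sigma>\<in>Sym n. W \<sigma> * of_bool (\<sigma> = \<tau>))"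
      unfolding sum_distrib_left sum.distrib[symmetric]
      by (intro sum.cong refl) (simp add: field_simps)
    \<comment> \<open>Exactly one of \<open>0 < ?x\<close> and \<open>?x = 0\<close> supplies the
      term with \<open>r i\<close>, and exactly one of \<open>?x < n - i\<close> and
      \<open>?x = n - i\<close> the term with \<open>1 - r i\<close>. The moves thus bring in a
      quarter of \<open>W \<tau>\<close>, and holding the rest.\<close>
    also have "\<dots> = W \<tau>"
      using x unfolding W_def sum_weight_raise[OF \<tau> i] sum_weight_lower[OF \<tau> i] 3[unfolded W_def]
      by (auto simp: field_simps)
    finally show ?thesis .
  qed
  have "(\<Sum>\<sigma>\<in>Sym n. W \<sigma> * pmf (M_inv n (choose_prob r) \<sigma>) \<tau>) =
    (\<Sum>\<sigma>\<in>Sym n. \<Sum>i\<in>{1..<n}. ?s i * (W \<sigma> *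
      ((1 - r i) / 4 * of_bool (raise n i \<sigma> = \<tau>) + r i / 4 * of_bool (lower n i \<sigma> = \<tau>)
        + 3 / 4 * of_bool (\<sigma> = \<tau>))))"
    by (intro sum.cong refl) (simp only: pmf sum_distrib_left mult.left_commute)
  also have "\<dots> = (\<Sum>i\<in>{1..<n}. ?s i * W \<tau>)"
    by (subst sum.swap) (simp only: one sum_distrib_left[symmetric] cong: sum.cong)
  also have "\<dots> = W \<tau>"
    by (simp only: sum_distrib_right[symmetric] sum_select_prob[OF n] mult_1)
  finally show ?thesis .
qed

section \<open>Contraction of the coupled chain\<close>

text \<open>The truncation at \<open>m\<close> makes \<open>Suc x\<close> and \<open>x\<close>
  equivalent at the upper end, just as \<open>x - 1\<close> equals \<open>x\<close> at 0 on the
  naturals. Holding at the ends of the segment is thereby built in.\<close>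

definition potential :: "nat \<Rightarrow> (nat \<Rightarrow> real) \<Rightarrow> nat \<Rightarrow> real" where
  "potential m w x = (\<Sum>k<min x m. w k)"

lemma potential_mono: "(\<And>k. 0 \<le> w k) \<Longrightarrow> x \<le> y \<Longrightarrow> potential m w x \<le> potential m w y"
  unfolding potential_def by (intro sum_mono2) auto

lemma potential_Suc: "k < m \<Longrightarrow> potential m w (Suc k) = potential m w k + w k"
  by (simp add: potential_def min_def)

text \<open>The difference of potentials is the total weight of the edges between \<open>x\<close>
  and \<open>y\<close>. Moving both walkers shifts every edge by one, with weight 0 once it leaves
  the segment, so the hypothesis is the claim for a single edge and the induction adds edges one at
  a time.\<close>

lemma potential_contraction_mono:
  assumes step: "\<And>k. k < m \<Longrightarrow>
      q * (if k = 0 then 0 else w (k - 1)) + (1 - q) * (if Suc k < m then w (Suc k) else 0)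
        \<le> (1 - c) * w k"
    and xy: "x \<le> y" "y \<le> m"
  shows "(1 - q) * (potential m w (Suc y) - potential m w (Suc x))
    + q * (potential m w (y - 1) - potential m w (x - 1)) \<le> (1 - c) * (potential m w y - potential m w x)"
  using xy
proof (induction y rule: dec_induct)
  case (step k)
  then have k: "k < m" by simp
  have 1: "potential m w (Suc (Suc k)) = potential m w (Suc k) + (if Suc k < m then w (Suc k) else 0)"
  proof (cases "Suc k < m")
    case False
    then have "min (Suc (Suc k)) m = min (Suc k) m" by simp
    then show ?thesis using False by (simp only: potential_def if_False add_0_right)
  qed (simp add: potential_Suc)
  have 2: "potential m w k = potential m w (k - 1) + (if k = 0 then 0 else w (k - 1))"
    using k potential_Suc[of "k - 1" m w] by (cases k) auto
  have 3: "potential m w (Suc k) = potential m w k + w k" using k by (rule potential_Suc)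
  show ?case using step.IH k assms(1)[OF k]
    unfolding 1 diff_Suc_1 using 2 3 by (simp add: algebra_simps)
qed simp

text \<open>The potential is monotone and the common moves preserve the order of the walkers, so all
  three absolute values open with the same sign.\<close>

lemma potential_contraction:
  assumes w: "\<And>k. 0 \<le> w k"
    and step: "\<And>k. k < m \<Longrightarrow>
      q * (if k = 0 then 0 else w (k - 1)) + (1 - q) * (if Suc k < m then w (Suc k) else 0)
        \<le> (1 - c) * w k"
    and xy: "x \<le> m" "y \<le> m"
  shows "(1 - q) * \<bar>potential m w (Suc x) - potential m w (Suc y)\<bar>
    + q * \<bar>potential m w (x - 1) - potential m w (y - 1)\<bar> \<le> (1 - c) * \<bar>potential m w x - potential m w y\<bar>"
  using xy
proof (induction x y rule: linorder_wlog)
  case (le x y)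
  have "potential m w (Suc x) \<le> potential m w (Suc y)" "potential m w (x - 1) \<le> potential m w (y - 1)"
    "potential m w x \<le> potential m w y" using le w by (auto intro!: potential_mono)
  then have
    "\<bar>potential m w (Suc x) - potential m w (Suc y)\<bar>
      = potential m w (Suc y) - potential m w (Suc x)"
    "\<bar>potential m w (x - 1) - potential m w (y - 1)\<bar>
      = potential m w (y - 1) - potential m w (x - 1)"
    "\<bar>potential m w x - potential m w y\<bar> = potential m w y - potential m w x" by linarith+
  then show ?case using potential_contraction_mono[OF step, of x y] le by (simp only:)
qed (simp add: abs_minus_commute)

text \<open>Distinct points are separated by at least one edge, of weight at least 1. This lets an
  expected distance bound a probability of disagreement.\<close>

lemma potential_diff_ge_1:
  assumes w: "\<And>k. 1 \<le> w k" and xy: "x \<le> m" "y \<le> m" "x \<noteq> y"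
  shows "1 \<le> \<bar>potential m w x - potential m w y\<bar>"
  using xy
proof (induction x y rule: linorder_wlog)
  case (le x y)
  then have "Suc x \<le> y" by simp
  moreover have "0 \<le> w k" for k using w[of k] by simp
  ultimately have "potential m w (Suc x) \<le> potential m w y" by (intro potential_mono)
  then show ?case using le w[of x] potential_Suc[of x m w] by simp
qed (simp add: abs_minus_commute)

lemma potential_diff_le:
  assumes w: "\<And>k. 0 \<le> w k"
  shows "\<bar>potential m w x - potential m w y\<bar> \<le> (\<Sum>k<m. w k)"
proof -
  have "0 \<le> potential m w z" "potential m w z \<le> (\<Sum>k<m. w k)" for z
    unfolding potential_def using w by (auto intro!: sum_nonneg sum_mono2)
  from this[of x] this[of y] show ?thesis by linarith
qed

section \<open>Two copies driven by the same randomness\<close>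

definition pair_kernel :: "nat \<Rightarrow> (nat \<Rightarrow> real) \<Rightarrow> (nat \<Rightarrow> nat) \<times> (nat \<Rightarrow> nat) \<Rightarrow>
    ((nat \<Rightarrow> nat) \<times> (nat \<Rightarrow> nat)) pmf" where
  "pair_kernel n r x = step_pmf n r (\<lambda>i. map_prod (raise n i) (raise n i) x)
     (\<lambda>i. map_prod (lower n i) (lower n i) x) x"

lemma set_pair_kernel:
  assumes "n \<ge> 2" "x \<in> Sym n \<times> Sym n"
  shows "set_pmf (pair_kernel n r x) \<subseteq> Sym n \<times> Sym n"
  unfolding pair_kernel_def
  by (rule set_step_pmf) (use assms in \<open>auto simp: raise_in_Sym lower_in_Sym\<close>)

lemma map_fst_pair_kernel:
  "x \<in> Sym n \<times> Sym n \<Longrightarrow> map_pmf fst (pair_kernel n r x) = M_inv n (choose_prob r) (fst x)"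
  by (auto simp: pair_kernel_def map_step_pmf M_inv_eq_step_pmf)

lemma map_snd_pair_kernel:
  "x \<in> Sym n \<times> Sym n \<Longrightarrow> map_pmf snd (pair_kernel n r x) = M_inv n (choose_prob r) (snd x)"
  by (auto simp: pair_kernel_def map_step_pmf M_inv_eq_step_pmf)

definition coord_dist :: "nat \<Rightarrow> nat \<Rightarrow> (nat \<Rightarrow> real) \<Rightarrow> (nat \<Rightarrow> nat) \<times> (nat \<Rightarrow> nat) \<Rightarrow> real" where
  "coord_dist n i w x = \<bar>potential (n - i) w (inv_table n (fst x) i) -
     potential (n - i) w (inv_table n (snd x) i)\<bar>"

lemma potential_inv_table_raise:
  assumes "\<sigma> \<in> Sym n"
  shows "potential (n - i) w (inv_table n (raise n i \<sigma>) i) = potential (n - i) w (Suc (inv_table n \<sigma> i))"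
proof (cases "inv_table n \<sigma> i < n - i")
  case False
  then have "inv_table n \<sigma> i = n - i" using inv_table_le[of n \<sigma> i] by simp
  then show ?thesis using raise_top[OF assms] by (simp add: potential_def)
qed (simp add: inv_table_raise[OF assms])

lemma potential_inv_table_lower:
  assumes "\<sigma> \<in> Sym n" "i \<in> {1..n}"
  shows "potential (n - i) w (inv_table n (lower n i \<sigma>) i) = potential (n - i) w (inv_table n \<sigma> i - 1)"
  using assms lower_bot[OF assms(1), of i] inv_table_lower[OF assms]
  by (cases "inv_table n \<sigma> i = 0") auto

lemma inv_table_raise_other:
  assumes "\<sigma> \<in> Sym n" "k \<noteq> i"
  shows "inv_table n (raise n k \<sigma>) i = inv_table n \<sigma> i"
  using assms inv_table_raise[OF assms(1), of k] raise_top[OF assms(1), of k] inv_table_le[of n \<sigma> k]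
  by (cases "inv_table n \<sigma> k < n - k") auto

lemma inv_table_lower_other:
  assumes "\<sigma> \<in> Sym n" "k \<in> {1..n}" "k \<noteq> i"
  shows "inv_table n (lower n k \<sigma>) i = inv_table n \<sigma> i"
  using assms inv_table_lower[OF assms(1,2)] lower_bot[OF assms(1), of k]
  by (cases "inv_table n \<sigma> k = 0") auto

lemma expectation_coord_dist_le:
  assumes n: "n \<ge> 2" and r: "\<And>i. i \<in> {1..<n} \<Longrightarrow> 0 \<le> r i \<and> r i \<le> 1" and i: "i \<in> {1..<n}"
    and x: "x \<in> Sym n \<times> Sym n" and w: "\<And>k. 0 \<le> w k"
    and step: "\<And>k. k < n - i \<Longrightarrow>
      r i * (if k = 0 then 0 else w (k - 1)) + (1 - r i) * (if Suc k < n - i then w (Suc k) else 0)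
        \<le> (1 - c) * w k"
  shows "measure_pmf.expectation (pair_kernel n r x) (coord_dist n i w)
    \<le> (1 - real (n - i) / real (n choose 2) * (c / 4)) * coord_dist n i w x"
proof -
  let ?s = "\<lambda>i. real (n - i) / real (n choose 2)" and ?d = "coord_dist n i w"
  let ?U = "\<lambda>k. map_prod (raise n k) (raise n k) x" and ?D = "\<lambda>k. map_prod (lower n k) (lower n k) x"
  have fs: "fst x \<in> Sym n" "snd x \<in> Sym n" using x by auto
  have i': "i \<in> {1..n}" using i by simp
  have same: "?d (?U k) = ?d x" "?d (?D k) = ?d x" if "k \<in> {1..<n}" "k \<noteq> i" for k
    using that fs by (simp_all add: coord_dist_def inv_table_raise_other inv_table_lower_other)
  have "(1 - r i) * ?d (?U i) + r i * ?d (?D i) \<le> (1 - c) * ?d x"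
    using potential_contraction[OF w step inv_table_le[of n "fst x" i] inv_table_le[of n "snd x" i]] fs i'
    by (simp add: coord_dist_def potential_inv_table_raise potential_inv_table_lower
        del: atLeastAtMost_iff)
  \<comment> \<open>Given that \<open>i\<close> is selected, a move is accepted with probability
    1/4, and (1 - c) / 4 + 3 / 4 = 1 - c / 4.\<close>
  then have "(1 - r i) / 4 * ?d (?U i) + r i / 4 * ?d (?D i) + 3 / 4 * ?d x \<le> (1 - c / 4) * ?d x"
    by (simp add: field_simps)
  then have bound: "(1 - r k) / 4 * ?d (?U k) + r k / 4 * ?d (?D k) + 3 / 4 * ?d x
      \<le> ?d x - (if k = i then c / 4 * ?d x else 0)" if "k \<in> {1..<n}" for k
    using same[OF that] by (cases "k = i") (simp_all add: field_simps)
  have "measure_pmf.expectation (pair_kernel n r x) ?d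
      = (\<Sum>k\<in>{1..<n}. ?s k * ((1 - r k) / 4 * ?d (?U k) + r k / 4 * ?d (?D k) + 3 / 4 * ?d x))"
    unfolding pair_kernel_def by (rule expectation_step_pmf[OF n r])
  also have "\<dots> \<le> (\<Sum>k\<in>{1..<n}. ?s k * (?d x - (if k = i then c / 4 * ?d x else 0)))"
    by (intro sum_mono mult_left_mono bound) auto
  also have "\<dots> = (\<Sum>k\<in>{1..<n}. ?s k * ?d x - (if k = i then ?s i * (c / 4 * ?d x) else 0))"
    by (intro sum.cong refl) (simp add: right_diff_distrib)
  also have "\<dots> = (\<Sum>k\<in>{1..<n}. ?s k) * ?d x - ?s i * (c / 4 * ?d x)"
    using i by (simp add: sum_subtractf sum_distrib_right del: atLeastLessThan_iff)
  finally show ?thesis unfolding sum_select_prob[OF n] by (simp add: algebra_simps)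
qed

text \<open>Two different permutations differ in some table entry, where the weighted distance is at
  least 1, so the probability of disagreement is at most the expected sum of the coordinate
  distances. Each coordinate contracts at its own rate from an initial distance of at most its total
  weight.\<close>

lemma prob_pair_neq_le:
  assumes n: "n \<ge> 2" and r: "\<And>i. i \<in> {1..<n} \<Longrightarrow> 0 \<le> r i \<and> r i \<le> 1"
    and x: "x \<in> Sym n \<times> Sym n"
    and w: "\<And>i k. 1 \<le> w i k" and c: "\<And>i. i \<in> {1..<n} \<Longrightarrow> c i \<le> 1"
    and step: "\<And>i k. \<lbrakk>i \<in> {1..<n}; k < n - i\<rbrakk> \<Longrightarrow>
      r i * (if k = 0 then 0 else w i (k - 1)) + (1 - r i) * (if Suc k < n - i then w i (Suc k) else 0)
        \<le> (1 - c i) * w i k"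
  shows "measure_pmf.prob (kernel_power (pair_kernel n r) t x) {p. fst p \<noteq> snd p}
    \<le> (\<Sum>i\<in>{1..<n}. (1 - real (n - i) / real (n choose 2) * (c i / 4)) ^ t * (\<Sum>k<n - i. w i k))"
proof -
  let ?C = "kernel_power (pair_kernel n r) t x" and ?S = "Sym n \<times> Sym n"
  let ?s = "\<lambda>i. real (n - i) / real (n choose 2)"
  have w0: "0 \<le> w i k" for i k using w[of i k] by simp
  have finS: "finite ?S" using finite_Sym by blast
  have sub: "set_pmf ?C \<subseteq> ?S" by (rule set_pmf_kernel_power[OF set_pair_kernel[OF n] x])
  have fin: "finite (set_pmf ?C)" using sub finS finite_subset by blast
  have s1: "?s i \<le> 1" if "i \<in> {1..<n}" for i
    using member_le_sum[OF that, of ?s] sum_select_prob[OF n] by simp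
  have "measure_pmf.prob ?C {p. fst p \<noteq> snd p}
      = measure_pmf.expectation ?C (indicator {p. fst p \<noteq> snd p})" by simp
  also have "\<dots> \<le> measure_pmf.expectation ?C (\<lambda>p. \<Sum>i\<in>{1..<n}. coord_dist n i (w i) p)"
  proof (rule integral_mono_AE)
    show "AE p in ?C. indicator {p. fst p \<noteq> snd p} p \<le> (\<Sum>i\<in>{1..<n}. coord_dist n i (w i) p)"
    proof (rule AE_pmfI)
      fix p assume "p \<in> set_pmf ?C"
      then have p: "fst p \<in> Sym n" "snd p \<in> Sym n" using sub by auto
      have nonneg: "0 \<le> coord_dist n i (w i) p" for i by (simp add: coord_dist_def)
      show "indicator {p. fst p \<noteq> snd p} p \<le> (\<Sum>i\<in>{1..<n}. coord_dist n i (w i) p)"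
      proof (cases "fst p = snd p")
        case False
        then obtain i where i: "i \<in> {1..<n}" "inv_table n (fst p) i \<noteq> inv_table n (snd p) i"
          using inv_table_inject[OF p] by blast
        have "1 \<le> coord_dist n i (w i) p"
          unfolding coord_dist_def by (intro potential_diff_ge_1 w inv_table_le i(2))
        also have "\<dots> \<le> (\<Sum>i\<in>{1..<n}. coord_dist n i (w i) p)"
          using nonneg i(1) by (intro member_le_sum) auto
        finally show ?thesis by (simp add: False)
      qed (simp add: nonneg sum_nonneg)
    qed
  qed (use fin in \<open>auto intro: integrable_measure_pmf_finite\<close>)
  also have "\<dots> = (\<Sum>i\<in>{1..<n}. measure_pmf.expectation ?C (coord_dist n i (w i)))"
    by (intro Bochner_Integration.integral_sum integrable_measure_pmf_finite fin)
  also have "\<dots> \<le> (\<Sum>i\<in>{1..<n}. (1 - ?s i * (c i / 4)) ^ t * (\<Sum>k<n - i. w i k))"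
  proof (rule sum_mono)
    fix i assume i: "i \<in> {1..<n}"
    have "?s i * (c i / 4) \<le> ?s i * 1" using c[OF i] by (intro mult_left_mono) auto
    also have "\<dots> \<le> 1" using s1[OF i] by simp
    finally have nn: "0 \<le> 1 - ?s i * (c i / 4)" by simp
    have "measure_pmf.expectation ?C (coord_dist n i (w i)) \<le> (1 - ?s i * (c i / 4)) ^ t * coord_dist n i (w i) x"
      by (intro expectation_kernel_power_le[OF finS set_pair_kernel[OF n] x nn]
          expectation_coord_dist_le[OF n r i] w0 step i)
    also have "\<dots> \<le> (1 - ?s i * (c i / 4)) ^ t * (\<Sum>k<n - i. w i k)"
      unfolding coord_dist_def by (intro mult_left_mono zero_le_power nn potential_diff_le w0)
    finally show "measure_pmf.expectation ?C (coord_dist n i (w i))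
        \<le> (1 - ?s i * (c i / 4)) ^ t * (\<Sum>k<n - i. w i k)" .
  qed
  finally show ?thesis .
qed

lemma tv_distance_M_inv_le:
  assumes n: "n \<ge> 2" and r: "\<And>i. i \<in> {1..<n} \<Longrightarrow> 0 < r i \<and> r i < 1"
    and B: "\<And>x. x \<in> Sym n \<times> Sym n \<Longrightarrow>
      measure_pmf.prob (kernel_power (pair_kernel n r) t x) {p. fst p \<noteq> snd p} \<le> B"
  shows "tv_distance (Sym n) (M_inv n (choose_prob r)) (target n (choose_prob r)) t \<le> B"
proof (rule tv_distance_le[OF finite_Sym Sym_nonempty set_M_inv[OF n]])
  let ?W = "weight n (choose_prob r)" and ?K = "M_inv n (choose_prob r)"
  have r': "0 \<le> r i \<and> r i \<le> 1" if "i \<in> {1..<n}" for i using r[OF that] by simp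
  have pos: "0 < ?W \<sigma>" if "\<sigma> \<in> Sym n" for \<sigma> using weight_pos[OF that r] .
  then have Z: "0 < (\<Sum>\<tau>\<in>Sym n. ?W \<tau>)"
    using finite_Sym Sym_nonempty by (intro sum_pos) auto
  show "(\<Sum>x\<in>Sym n. target n (choose_prob r) x * pmf (?K x) y) = target n (choose_prob r) y"
    if "y \<in> Sym n" for y
    using weight_stationary[OF n r' that] by (simp add: target_def flip: sum_divide_distrib)
  show "0 \<le> target n (choose_prob r) x" if "x \<in> Sym n" for x
    using pos[OF that] Z by (simp add: target_def)
  show "(\<Sum>x\<in>Sym n. target n (choose_prob r) x) = 1"
    using Z by (simp add: target_def flip: sum_divide_distrib)
  show "(\<Sum>z\<in>Sym n. \<bar>pmf (kernel_power ?K t x) z - pmf (kernel_power ?K t y) z\<bar>) \<le> 2 * B"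
    if "x \<in> Sym n" "y \<in> Sym n" for x y
  proof -
    have xy: "(x, y) \<in> Sym n \<times> Sym n" using that by simp
    let ?C = "kernel_power (pair_kernel n r) t (x, y)"
    have "map_pmf fst ?C = kernel_power ?K t x"
      using map_kernel_power[where f = fst and K = ?K, OF set_pair_kernel[OF n, of _ r] xy
          map_fst_pair_kernel, of t] by simp
    moreover have "map_pmf snd ?C = kernel_power ?K t y"
      using map_kernel_power[where f = snd and K = ?K, OF set_pair_kernel[OF n, of _ r] xy
          map_snd_pair_kernel, of t] by simp
    ultimately show ?thesis using tv_coupling_le[OF finite_Sym, of ?C n] B[OF xy] by simp
  qed
qed

section \<open>Mixing time bounds\<close>

text \<open>Each of the n - 1 coordinates is allotted \<epsilon> / n. With 1 - x \<le> exp (- x),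
  and with \<open>h i\<close> bounding the logarithm of the total weight, the requirement on
  \<open>t\<close> becomes linear.\<close>

lemma tv_distance_M_inv_le_eps:
  assumes n: "n \<ge> 2" and r: "\<And>i. i \<in> {1..<n} \<Longrightarrow> 0 < r i \<and> r i < 1"
    and w: "\<And>i k. 1 \<le> w i k" and c: "\<And>i. i \<in> {1..<n} \<Longrightarrow> c i \<le> 1"
    and step: "\<And>i k. \<lbrakk>i \<in> {1..<n}; k < n - i\<rbrakk> \<Longrightarrow>
      r i * (if k = 0 then 0 else w i (k - 1)) + (1 - r i) * (if Suc k < n - i then w i (Suc k) else 0)
        \<le> (1 - c i) * w i k"
    and \<epsilon>: "0 < \<epsilon>"
    and H: "\<And>i. i \<in> {1..<n} \<Longrightarrow> (\<Sum>k<n - i. w i k) \<le> exp (h i)"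
    and t: "\<And>i. i \<in> {1..<n} \<Longrightarrow>
      h i + ln (real n / \<epsilon>) \<le> real (n - i) / real (n choose 2) * (c i / 4) * real t"
  shows "tv_distance (Sym n) (M_inv n (choose_prob r)) (target n (choose_prob r)) t \<le> \<epsilon>"
proof (rule tv_distance_M_inv_le[OF n r])
  let ?s = "\<lambda>i. real (n - i) / real (n choose 2)"
  fix x assume x: "x \<in> Sym n \<times> Sym n"
  have r': "0 \<le> r i \<and> r i \<le> 1" if "i \<in> {1..<n}" for i using r[OF that] by simp
  have "measure_pmf.prob (kernel_power (pair_kernel n r) t x) {p. fst p \<noteq> snd p}
      \<le> (\<Sum>i\<in>{1..<n}. (1 - ?s i * (c i / 4)) ^ t * (\<Sum>k<n - i. w i k))"
    by (rule prob_pair_neq_le[OF n r' x w c step])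
  also have "\<dots> \<le> (\<Sum>i\<in>{1..<n}. \<epsilon> / real n)"
  proof (rule sum_mono)
    fix i assume i: "i \<in> {1..<n}"
    have "?s i * (c i / 4) \<le> ?s i * 1" using c[OF i] by (intro mult_left_mono) auto
    also have "\<dots> \<le> 1" using member_le_sum[OF i, of ?s] sum_select_prob[OF n] by simp
    finally have nn: "0 \<le> 1 - ?s i * (c i / 4)" by simp
    have "(1 - ?s i * (c i / 4)) ^ t \<le> exp (- (?s i * (c i / 4))) ^ t"
      using exp_ge_add_one_self[of "- (?s i * (c i / 4))"] by (intro power_mono nn) simp
    also have "\<dots> = exp (- (?s i * (c i / 4) * real t))"
      by (simp add: exp_of_nat_mult[symmetric] mult.commute)
    finally have "(1 - ?s i * (c i / 4)) ^ t * (\<Sum>k<n - i. w i k)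
        \<le> exp (- (?s i * (c i / 4) * real t)) * exp (h i)"
      using H[OF i] order_trans[OF zero_le_one w] by (intro mult_mono) (auto intro!: sum_nonneg)
    also have "\<dots> = exp (h i - ?s i * (c i / 4) * real t)" by (simp flip: exp_add)
    also have "\<dots> \<le> exp (- ln (real n / \<epsilon>))" using t[OF i] by simp
    also have "\<dots> = \<epsilon> / real n" using n \<epsilon> by (simp add: exp_minus)
    finally show "(1 - ?s i * (c i / 4)) ^ t * (\<Sum>k<n - i. w i k) \<le> \<epsilon> / real n" .
  qed
  also have "\<dots> \<le> \<epsilon>" using n \<epsilon> by (simp add: field_simps)
  finally show "measure_pmf.prob (kernel_power (pair_kernel n r) t x) {p. fst p \<noteq> snd p} \<le> \<epsilon>" .
qed

lemma tv_distance_M_inv_le_1: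
  assumes "n \<ge> 2" "\<And>i. i \<in> {1..<n} \<Longrightarrow> 0 < r i \<and> r i < 1"
  shows "tv_distance (Sym n) (M_inv n (choose_prob r)) (target n (choose_prob r)) t \<le> 1"
  by (rule tv_distance_M_inv_le[OF assms]) simp_all

lemma select_prob_ge:
  assumes "n \<ge> 2"
  shows "2 * real (n - i) / real n ^ 2 \<le> real (n - i) / real (n choose 2)"
proof -
  have "real (n choose 2) = real (n * (n - 1)) / 2"
    unfolding choose_two by (subst real_of_nat_div) auto
  then have c: "real (n choose 2) = real n * (real n - 1) / 2" using assms by (simp add: of_nat_diff)
  have "real n * (real n - 1) / 2 \<le> real n ^ 2 / 2" by (simp add: power2_eq_square algebra_simps)
  then have "real (n - i) / (real n ^ 2 / 2) \<le> real (n - i) / real (n choose 2)"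
    unfolding c using assms by (intro divide_left_mono mult_pos_pos) auto
  then show ?thesis by (simp add: mult.commute)
qed

lemma ln_div_ge_half:
  assumes "n \<ge> 2" "0 < \<epsilon>" "\<epsilon> \<le> 1"
  shows "1 / 2 \<le> ln (real n / \<epsilon>)"
proof -
  have "real n / 1 \<le> real n / \<epsilon>" using assms by (intro divide_left_mono) auto
  then have "2 \<le> real n / \<epsilon>" using assms by simp
  then have "ln 2 \<le> ln (real n / \<epsilon>)" by simp
  then show ?thesis using ln2_ge_two_thirds by simp
qed

text \<open>For \<epsilon> \<le> 1 the rounding term 1 is absorbed, since \<open>real n ^ m\<close>
  is at least 2 and the logarithm at least 1/2. For \<epsilon> > 1 the mixing time is 0, and
  \<epsilon> \<le> n keeps the right-hand side nonnegative.\<close>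

lemma tau_inv_le:
  assumes n: "n \<ge> 2" and r: "\<And>i. i \<in> {1..<n} \<Longrightarrow> 0 < r i \<and> r i < 1"
    and \<epsilon>: "0 < \<epsilon>" "\<epsilon> \<le> real n" and C: "0 \<le> C" and m: "m \<ge> 1"
    and tv: "\<And>t. \<lbrakk>\<epsilon> \<le> 1; C * real n ^ m * ln (real n / \<epsilon>) \<le> real t\<rbrakk> \<Longrightarrow>
      tv_distance (Sym n) (M_inv n (choose_prob r)) (target n (choose_prob r)) t \<le> \<epsilon>"
  shows "ereal_of_enat (tau_inv n (choose_prob r) \<epsilon>)
    \<le> ereal ((C + 1) * real n ^ m * ln (real n / \<epsilon>))"
proof (cases "\<epsilon> \<le> 1")
  case True
  let ?L = "ln (real n / \<epsilon>)"
  have L: "1 / 2 \<le> ?L" by (rule ln_div_ge_half[OF n \<epsilon>(1) True])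
  have "2 \<le> real n ^ 1" using n by simp
  also have "\<dots> \<le> real n ^ m" using n m by (intro power_increasing) auto
  finally have "2 * (1 / 2) \<le> real n ^ m * ?L" using L by (intro mult_mono) auto
  moreover have "ereal_of_enat (tau_inv n (choose_prob r) \<epsilon>) \<le> ereal (C * real n ^ m * ?L + 1)"
    unfolding tau_inv_def using L C tv[OF True] by (intro mixing_time_le) auto
  ultimately show ?thesis
    by (elim order_trans) (simp add: algebra_simps)
next
  case False
  have "tau_inv n (choose_prob r) \<epsilon> = 0"
    unfolding tau_inv_def
  proof (rule mixing_time_eq_0)
    fix t
    show "tv_distance (Sym n) (M_inv n (choose_prob r)) (target n (choose_prob r)) t \<le> \<epsilon>"
      using tv_distance_M_inv_le_1[where r = r and t = t, OF n r] False by simp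
  qed
  moreover have "0 \<le> ln (real n / \<epsilon>)" using \<epsilon> by simp
  ultimately show ?thesis using C by simp
qed

text \<open>Geometric weights contract at the constant rate \<open>\<delta> ^ 2\<close> but have a
  total whose logarithm can grow linearly in \<open>n - i\<close>. The selection probability is
  proportional to \<open>n - i\<close> as well and compensates for this growth, which is what makes
  order n^2 suffice.\<close>

lemma tau_inv_le_biased:
  assumes \<delta>: "0 < \<delta>" and n: "n \<ge> 2"
    and r: "\<And>i. i \<in> {1..<n} \<Longrightarrow> 1 / 2 + \<delta> \<le> r i \<and> r i < 1"
    and \<epsilon>: "0 < \<epsilon>" "\<epsilon> \<le> real n"
  shows "ereal_of_enat (tau_inv n (choose_prob r) \<epsilon>)
    \<le> ereal ((6 / \<delta> ^ 2 + 1) * real n ^ 2 * ln (real n / \<epsilon>))"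
proof (rule tau_inv_le[OF n _ \<epsilon>])
  let ?L = "ln (real n / \<epsilon>)" and ?w = "\<lambda>(i::nat) k. (1 + \<delta>) ^ k"
  have \<delta>1: "\<delta> < 1 / 2" using r[of 1] n by simp
  show r01: "0 < r i \<and> r i < 1" if "i \<in> {1..<n}" for i using r[OF that] \<delta> by simp
  fix t assume \<epsilon>1: "\<epsilon> \<le> 1" and t: "6 / \<delta> ^ 2 * real n ^ 2 * ?L \<le> real t"
  have L: "1 / 2 \<le> ?L" by (rule ln_div_ge_half[OF n \<epsilon>(1) \<epsilon>1])
  show "tv_distance (Sym n) (M_inv n (choose_prob r)) (target n (choose_prob r)) t \<le> \<epsilon>"
  proof (rule tv_distance_M_inv_le_eps[where w = ?w and c = "\<lambda>_. \<delta> ^ 2"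
        and h = "\<lambda>i. \<delta> * real (n - i) + ln (real n)", OF n r01 _ _ _ \<epsilon>(1)])
    fix i k
    show "1 \<le> ?w i k" using \<delta> by simp
  next
    show "\<delta> ^ 2 \<le> 1" using \<delta> \<delta>1 by (simp add: power_le_one)
  next
    fix i k assume i: "i \<in> {1..<n}" and k: "k < n - i"
    have ri: "1 / 2 + \<delta> \<le> r i" "r i < 1" using r[OF i] by auto
    \<comment> \<open>The factor is decreasing in \<open>r i\<close>, so the worst case is \<open>r i = 1 / 2 + \<delta>\<close>.\<close>
    have "r i + (1 - r i) * (1 + \<delta>) ^ 2 = 1 + (1 - r i) * (2 * \<delta> + \<delta> ^ 2)"
      by (simp add: power2_eq_square algebra_simps)
    also have "\<dots> \<le> 1 + (1 / 2 - \<delta>) * (2 * \<delta> + \<delta> ^ 2)"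
      using ri \<delta> by (intro add_left_mono mult_right_mono) auto
    \<comment> \<open>The two sides differ by \<delta>^2 / 2, which is the room that permits the
      rate \<open>\<delta> ^ 2\<close>.\<close>
    also have "\<dots> \<le> (1 - \<delta> ^ 2) * (1 + \<delta>)"
      using \<delta> by (simp add: power2_eq_square algebra_simps)
    finally have key: "r i + (1 - r i) * (1 + \<delta>) ^ 2 \<le> (1 - \<delta> ^ 2) * (1 + \<delta>)" .
    show "r i * (if k = 0 then 0 else ?w i (k - 1)) + (1 - r i) * (if Suc k < n - i then ?w i (Suc k) else 0)
        \<le> (1 - \<delta> ^ 2) * ?w i k"
    proof -
      \<comment> \<open>This is the geometric weight continued to index \<open>k - 1\<close>, also
        for \<open>k = 0\<close>; weights missing at either end are bounded by their positive
        continuations.\<close>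
      define z where "z = (1 + \<delta>) ^ k / (1 + \<delta>)"
      have z: "0 \<le> z" "(1 + \<delta>) ^ k = (1 + \<delta>) * z" using \<delta> by (auto simp: z_def)
      have "r i * (if k = 0 then 0 else ?w i (k - 1)) \<le> r i * z"
        using z ri \<delta> by (intro mult_left_mono) (cases k; auto simp: z_def)+
      moreover have "(1 - r i) * (if Suc k < n - i then ?w i (Suc k) else 0) \<le> (1 - r i) * ((1 + \<delta>) ^ 2 * z)"
        using z ri \<delta> by (intro mult_left_mono) (auto simp: power2_eq_square)
      moreover have "(r i + (1 - r i) * (1 + \<delta>) ^ 2) * z \<le> (1 - \<delta> ^ 2) * (1 + \<delta>) * z"
        using key z(1) by (rule mult_right_mono)
      ultimately show ?thesis unfolding z(2) by (simp add: algebra_simps)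
    qed
  next
    fix i assume i: "i \<in> {1..<n}"
    have "(\<Sum>k<n - i. ?w i k) \<le> (\<Sum>k<n - i. exp (\<delta> * real (n - i)))"
    proof (rule sum_mono)
      fix k assume k: "k \<in> {..<n - i}"
      have "(1 + \<delta>) ^ k \<le> exp \<delta> ^ k" using \<delta> exp_ge_add_one_self by (intro power_mono) auto
      also have "\<dots> = exp (\<delta> * real k)" by (simp add: exp_of_nat_mult[symmetric] mult.commute)
      also have "\<dots> \<le> exp (\<delta> * real (n - i))" using k \<delta> by simp
      finally show "?w i k \<le> exp (\<delta> * real (n - i))" .
    qed
    also have "\<dots> \<le> real n * exp (\<delta> * real (n - i))"
      unfolding sum_constant card_lessThan by (intro mult_right_mono) auto
    also have "\<dots> = exp (\<delta> * real (n - i) + ln (real n))" using n by (simp add: exp_add)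
    finally show "(\<Sum>k<n - i. ?w i k) \<le> exp (\<delta> * real (n - i) + ln (real n))" .
    define m where "m = real (n - i)"
    have m: "1 \<le> m" using i by (auto simp: m_def)
    have "real n \<le> real n / \<epsilon>" using \<epsilon>(1) \<epsilon>1 n by (simp add: field_simps)
    then have "ln (real n) \<le> ?L" using n by simp
    then have "\<delta> * m + ln (real n) + ?L \<le> \<delta> * m + 2 * ?L" by simp
    \<comment> \<open>Here \<delta> < 1/2 \<le> \<open>?L\<close> and 1 \<le> \<open>m\<close>. The
      resulting 3 \<open>?L\<close> \<open>m\<close> divided by the rate (2m / n^2)(\<delta>^2 / 4)
      is the 6 n^2 \<open>?L\<close> / \<delta>^2 required of \<open>t\<close>.\<close>
    also have "\<dots> \<le> ?L * m + 2 * ?L * m"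
      using m L \<delta>1 \<delta> by (intro add_mono mult_right_mono) (auto simp: field_simps)
    also have "\<dots> = (2 * m / real n ^ 2) * (\<delta> ^ 2 / 4) * (6 / \<delta> ^ 2 * real n ^ 2 * ?L)"
      using \<delta> n by (simp add: field_simps)
    also have "\<dots> \<le> (2 * m / real n ^ 2) * (\<delta> ^ 2 / 4) * real t"
      using m by (intro mult_left_mono t) auto
    also have "\<dots> \<le> real (n - i) / real (n choose 2) * (\<delta> ^ 2 / 4) * real t"
      unfolding m_def by (intro mult_right_mono select_prob_ge n) auto
    finally show "\<delta> * real (n - i) + ln (real n) + ?L \<le> real (n - i) / real (n choose 2) * (\<delta> ^ 2 / 4) * real t"
      by (simp add: m_def)
  qed
qed (use \<delta> in auto)

text \<open>Without a bias the rate comes from concavity: one step lowers the quadratic weight by at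
  least 1 on average, and the weight is at most \<open>(m i + 1) ^ 2\<close>. The value 1 beyond the
  segment keeps all weights at least 1.\<close>

lemma tau_inv_le_general:
  assumes n: "n \<ge> 2" and r: "\<And>i. i \<in> {1..<n} \<Longrightarrow> 1 / 2 \<le> r i \<and> r i < 1"
    and \<epsilon>: "0 < \<epsilon>" "\<epsilon> \<le> real n"
  shows "ereal_of_enat (tau_inv n (choose_prob r) \<epsilon>) \<le> ereal ((16 + 1) * real n ^ 3 * ln (real n / \<epsilon>))"
proof (rule tau_inv_le[OF n _ \<epsilon>])
  let ?L = "ln (real n / \<epsilon>)"
  define m where "m i = real (n - i)" for i
  \<comment> \<open>The quadratic has second difference \<open>-2\<close>, vanishes at \<open>k = -1\<close> and increases up to \<open>k = n - i\<close>.\<close>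
  define w where "w i k = (if k < n - i then (real k + 1) * (2 * m i + 1 - real k) else 1)" for i k
  show r01: "0 < r i \<and> r i < 1" if "i \<in> {1..<n}" for i using r[OF that] by simp
  fix t assume \<epsilon>1: "\<epsilon> \<le> 1" and t: "16 * real n ^ 3 * ?L \<le> real t"
  have L: "1 / 2 \<le> ?L" by (rule ln_div_ge_half[OF n \<epsilon>(1) \<epsilon>1])
  have m1: "1 \<le> m i" "m i + 1 \<le> real n" if "i \<in> {1..<n}" for i using that by (auto simp: m_def)
  have w_le: "w i k \<le> (m i + 1) ^ 2" if "k < n - i" for i k
  proof -
    have "(m i + 1) ^ 2 - (real k + 1) * (2 * m i + 1 - real k) = (m i - real k) ^ 2"
      by (simp add: power2_eq_square algebra_simps)
    then have "(real k + 1) * (2 * m i + 1 - real k) \<le> (m i + 1) ^ 2"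
      using zero_le_power2[of "m i - real k"] by linarith
    then show ?thesis using that by (simp add: w_def)
  qed
  have w1: "1 \<le> w i k" for i k
  proof (cases "k < n - i")
    case True
    then have "real k < m i" by (simp add: m_def)
    then have "1 * 1 \<le> (real k + 1) * (2 * m i + 1 - real k)" by (intro mult_mono) auto
    then show ?thesis using True by (simp add: w_def)
  qed (simp add: w_def)
  show "tv_distance (Sym n) (M_inv n (choose_prob r)) (target n (choose_prob r)) t \<le> \<epsilon>"
  proof (rule tv_distance_M_inv_le_eps[where w = w and c = "\<lambda>i. 1 / (m i + 1) ^ 2"
        and h = "\<lambda>i. 3 * ln (real n)", OF n r01 w1 _ _ \<epsilon>(1)])
    fix i assume "i \<in> {1..<n}"
    then show "1 / (m i + 1) ^ 2 \<le> 1" using m1[of i] by (simp add: one_le_power)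
  next
    fix i k assume i: "i \<in> {1..<n}" and k: "k < n - i"
    define v where "v x = (x + 1) * (2 * m i + 1 - x)" for x
    let ?x = "real k"
    have x: "?x + 1 \<le> m i" using k by (simp add: m_def)
    \<comment> \<open>The missing edge below the segment is matched exactly by v(-1) = 0; the
      missing edge above is covered by \<open>v (?x + 1)\<close> being nonnegative.\<close>
    have "r i * (if k = 0 then 0 else w i (k - 1)) = r i * v (?x - 1)"
      using k by (cases k) (auto simp: w_def v_def)
    moreover have "(1 - r i) * (if Suc k < n - i then w i (Suc k) else 0) \<le> (1 - r i) * v (?x + 1)"
      using r[OF i] x by (intro mult_left_mono) (auto simp: w_def v_def add_ac)
    \<comment> \<open>Split into the symmetric average, which is \<open>v ?x - 1\<close>, and a
      drift term, which only helps because \<open>r i\<close> is at least 1/2 and \<open>v\<close>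
      increases.\<close>
    moreover have "r i * v (?x - 1) + (1 - r i) * v (?x + 1)
      = (v (?x - 1) + v (?x + 1)) / 2 - (r i - 1 / 2) * (v (?x + 1) - v (?x - 1))"
      by (simp add: field_simps)
    moreover have "0 \<le> (r i - 1 / 2) * (v (?x + 1) - v (?x - 1))"
    proof (rule mult_nonneg_nonneg)
      have "v (?x + 1) - v (?x - 1) = 4 * (m i - ?x)" by (simp add: v_def algebra_simps)
      then show "0 \<le> v (?x + 1) - v (?x - 1)" using x by simp
    qed (use r[OF i] in simp)
    moreover have "(v (?x - 1) + v (?x + 1)) / 2 = v ?x - 1" by (simp add: v_def field_simps)
    moreover have "v ?x = w i k" using k by (simp add: w_def v_def)
    moreover have "1 / (m i + 1) ^ 2 * w i k \<le> 1"
      using w_le[OF k] m1[OF i] by (simp add: divide_le_eq)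
    ultimately show "r i * (if k = 0 then 0 else w i (k - 1)) + (1 - r i) * (if Suc k < n - i then w i (Suc k) else 0)
        \<le> (1 - 1 / (m i + 1) ^ 2) * w i k"
      unfolding left_diff_distrib by linarith
  next
    fix i assume i: "i \<in> {1..<n}"
    have "(\<Sum>k<n - i. w i k) \<le> (\<Sum>k<n - i. real n ^ 2)"
    proof (rule sum_mono)
      fix k assume "k \<in> {..<n - i}"
      then have "w i k \<le> (m i + 1) ^ 2" by (intro w_le) simp
      also have "\<dots> \<le> real n ^ 2" using m1[OF i] by (intro power_mono) auto
      finally show "w i k \<le> real n ^ 2" .
    qed
    also have "\<dots> \<le> real n * real n ^ 2"
      unfolding sum_constant card_lessThan by (intro mult_right_mono) auto
    also have "\<dots> = exp (ln (real n)) ^ 3" using n by (simp add: power2_eq_square power3_eq_cube)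
    also have "\<dots> = exp (3 * ln (real n))" using exp_of_nat_mult[of 3 "ln (real n)"] by simp
    finally show "(\<Sum>k<n - i. w i k) \<le> exp (3 * ln (real n))" .
    have "real n \<le> real n / \<epsilon>" using \<epsilon>(1) \<epsilon>1 n by (simp add: field_simps)
    then have "ln (real n) \<le> ?L" using n by simp
    then have "3 * ln (real n) + ?L \<le> 4 * ?L" by simp
    \<comment> \<open>From m + 1 \<le> 2m and m + 1 \<le> n follows (m + 1)^2 \<le> 2mn, so the rate
      (2m / n^2) / (4 (m + 1)^2) is at least 1 / (4 n^3). Reaching 4 \<open>?L\<close> at this rate
      gives the constant 16.\<close>
    also have "\<dots> = (1 / (4 * real n ^ 3)) * (16 * real n ^ 3 * ?L)" using n by simp
    also have "\<dots> \<le> (1 / (4 * real n ^ 3)) * real t" by (intro mult_left_mono t) simp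
    also have "\<dots> \<le> (2 * m i / real n ^ 2) * (1 / (m i + 1) ^ 2 / 4) * real t"
    proof (rule mult_right_mono)
      have "(m i + 1) ^ 2 \<le> (2 * m i) * real n"
        unfolding power2_eq_square using m1[OF i] by (intro mult_mono) auto
      then have "2 * m i / real n ^ 2 * (1 / (2 * m i * real n) / 4)
          \<le> 2 * m i / real n ^ 2 * (1 / (m i + 1) ^ 2 / 4)"
        using m1[OF i] n
        by (intro mult_left_mono divide_right_mono divide_left_mono mult_pos_pos) auto
      moreover have "1 / (4 * real n ^ 3) = 2 * m i / real n ^ 2 * (1 / (2 * m i * real n) / 4)"
        using m1[OF i] n by (simp add: power2_eq_square power3_eq_cube)
      ultimately show "1 / (4 * real n ^ 3) \<le> 2 * m i / real n ^ 2 * (1 / (m i + 1) ^ 2 / 4)"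
        by simp
    qed simp
    also have "\<dots> \<le> real (n - i) / real (n choose 2) * (1 / (m i + 1) ^ 2 / 4) * real t"
      unfolding m_def by (intro mult_right_mono select_prob_ge n) auto
    finally show "3 * ln (real n) + ?L \<le> real (n - i) / real (n choose 2) * (1 / (m i + 1) ^ 2 / 4) * real t" .
  qed
qed auto

text \<open>The margin \<delta> expresses that the \<open>r i\<close> stay away from 1/2
  independently of \<open>n\<close>. Each \<open>C\<close> is chosen before \<open>n\<close>,
  \<open>r\<close> and \<epsilon>: it is 6 / \<delta>^2 + 1 in the first part and 17 in the second.
  The range \<epsilon> \<le> n keeps the logarithm nonnegative.\<close>

theorem theorem3:
  fixes \<delta> :: real
  assumes "0 < \<delta>"
  shows
    "(\<exists>C::real. \<forall>n\<ge>2. \<forall>r :: nat \<Rightarrow> real.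
        (\<forall>i\<in>{1..<n}. 1 / 2 \<le> r i \<and> r i < 1) \<longrightarrow>
        (\<forall>i\<in>{1..<n}. 1 / 2 + \<delta> \<le> r i) \<longrightarrow>
        (\<forall>\<epsilon>::real. 0 < \<epsilon> \<and> \<epsilon> \<le> real n \<longrightarrow>
          ereal_of_enat (tau_inv n (choose_prob r) \<epsilon>)
            \<le> ereal (C * real n ^ 2 * ln (real n / \<epsilon>)))) \<and>
     (\<exists>C::real. \<forall>n\<ge>2. \<forall>r :: nat \<Rightarrow> real.
        (\<forall>i\<in>{1..<n}. 1 / 2 \<le> r i \<and> r i < 1) \<longrightarrow>
        \<not> (\<forall>i\<in>{1..<n}. 1 / 2 + \<delta> \<le> r i) \<longrightarrow>
        (\<forall>\<epsilon>::real. 0 < \<epsilon> \<and> \<epsilon> \<le> real n \<longrightarrow>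
          ereal_of_enat (tau_inv n (choose_prob r) \<epsilon>)
            \<le> ereal (C * real n ^ 3 * ln (real n / \<epsilon>))))"
proof (intro conjI exI allI impI)
  fix n :: nat and r :: "nat \<Rightarrow> real" and \<epsilon> :: real
  assume n: "2 \<le> n" and r: "\<forall>i\<in>{1..<n}. 1 / 2 \<le> r i \<and> r i < 1" and \<epsilon>: "0 < \<epsilon> \<and> \<epsilon> \<le> real n"
  then show "ereal_of_enat (tau_inv n (choose_prob r) \<epsilon>)
      \<le> ereal ((16 + 1) * real n ^ 3 * ln (real n / \<epsilon>))"
    by (intro tau_inv_le_general) auto
  assume "\<forall>i\<in>{1..<n}. 1 / 2 + \<delta> \<le> r i"
  then show "ereal_of_enat (tau_inv n (choose_prob r) \<epsilon>)
      \<le> ereal ((6 / \<delta> ^ 2 + 1) * real n ^ 2 * ln (real n / \<epsilon>))"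
    using assms n r \<epsilon> by (intro tau_inv_le_biased) auto
qed

end
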